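(* Let $d\ge2$ and let $f:\mathbf{Sym}_d^+\to\mathbb{R}^+$ be a continuous function, homogeneous of degree $\frac d{d-1}$, that displays a maximal gain of integrability. Then there exists a finite constant $c_f'$ such that $$\int_{S^{d-1}}f\bigl(m\,e\otimes e+(d-1-m)I_d\bigr)\,ds(e)\le c_f'\,(d-1-m)$$ for every real $m<d-1$. Moreover, $f$ vanishes on the cone of rank-one tensors: $f(v\otimes v)=0$ for every $v\in\mathbb{R}^d$.
   Context: $\mathbf{Sym}_d^+$ is the cone of real symmetric positive semi-definite $d\times d$ matrices; $ds$ is the surface measure on the unit sphere $S^{d-1}$. Definition. A continuous function $f:\mathbf{Sym}_d^+\to\mathbb{R}^+$, homogeneous of degree $\frac d{d-1}$, displays a maximal gain of integrability if there is a finite constant $c_f$ such that, with $B$ the unit ball of $\mathbb{R}^d$, every divergence-free $T\in L^1(B;\mathbf{Sym}_d^+)$ with an integrable normal trace on $S^{d-1}=\partial B$ satisfies $$\int_Bf(T)\,dx\le c_f\,\|T\vec n\|_{L^1(S^{d-1})}^{\frac d{d-1}}.$$ Here divergence-free means $\sum_j\partial_jT_{ij}=0$ for every $i$ in the sense of distributions, $\vec n$ is the outward unit normal, and the normal trace $T\vec n$ is defined by $\langle T\vec n,\psi\rangle=\int_B\mathrm{Tr}(T\nabla\psi)\,dx$ for $\psi\in C^\infty(\mathbb{R}^d;\mathbb{R}^d)$. *)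

theory Defs
  imports "HOL-Analysis.Analysis"
begin

definition Sym_psd :: "(real^'n^'n) set" where
  "Sym_psd = {A. transpose A = A \<and> (\<forall>x. 0 \<le> x \<bullet> (A *v x))}"

definition tensor :: "real^'n \<Rightarrow> real^'n \<Rightarrow> real^'n^'n" where
  "tensor v w = (\<chi> i j. v $ i * w $ j)"

text \<open>The surface measure of the unit sphere, on its Borel sets: the measure of \<open>A\<close> is \<open>d\<close> times
  the Lebesgue measure of the truncated cone \<open>{r *\<^sub>R e | 0 < r < 1, e \<in> A}\<close>
  (the measure of integration in polar coordinates).\<close>

definition sphere_measure :: "(real^'n) measure" where
  "sphere_measure = scale_measure (of_nat CARD('n))
     (distr (restrict_space lborel (ball 0 1 - {0})) (restrict_space borel (sphere 0 1))
       (\<lambda>x. x /\<^sub>R norm x))"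

fun C_k :: "nat \<Rightarrow> ('a::euclidean_space \<Rightarrow> 'b::real_normed_vector) \<Rightarrow> bool" where
  "C_k 0 f \<longleftrightarrow> continuous_on UNIV f"
| "C_k (Suc k) f \<longleftrightarrow> (\<forall>x. f differentiable (at x)) \<and>
     (\<forall>v. C_k k (\<lambda>x. frechet_derivative f (at x) v))"

definition C_infinity :: "('a::euclidean_space \<Rightarrow> 'b::real_normed_vector) \<Rightarrow> bool" where
  "C_infinity f \<longleftrightarrow> (\<forall>k. C_k k f)"

definition test_function :: "'a::euclidean_space set \<Rightarrow> ('a \<Rightarrow> real) \<Rightarrow> bool" where
  "test_function U \<phi> \<longleftrightarrow> C_infinity \<phi> \<and>
     compact (closure {x. \<phi> x \<noteq> 0}) \<and> closure {x. \<phi> x \<noteq> 0} \<subseteq> U"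

text \<open>\<open>\<Sum>j. \<partial>\<^sub>j T\<^sub>i\<^sub>j = 0\<close> for every \<open>i\<close>, in the sense of distributions on the open unit ball.\<close>

definition divergence_free :: "(real^'n \<Rightarrow> real^'n^'n) \<Rightarrow> bool" where
  "divergence_free T \<longleftrightarrow> (\<forall>i. \<forall>\<phi>. test_function (ball 0 1) \<phi> \<longrightarrow>
     (\<Sum>j\<in>UNIV. LINT x:ball 0 1|lebesgue.
        T x $ i $ j * frechet_derivative \<phi> (at x) (axis j 1)) = 0)"

text \<open>The normal trace of \<open>T\<close>, a priori only a distribution on the sphere, is the function \<open>g\<close>,
  integrable for the surface measure.\<close>

definition has_integrable_normal_trace ::
    "(real^'n \<Rightarrow> real^'n^'n) \<Rightarrow> (real^'n \<Rightarrow> real^'n) \<Rightarrow> bool" where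
  "has_integrable_normal_trace T g \<longleftrightarrow> integrable sphere_measure g \<and>
     (\<forall>\<psi> :: real^'n \<Rightarrow> real^'n. C_infinity \<psi> \<longrightarrow>
        (LINT e|sphere_measure. g e \<bullet> \<psi> e) =
        (LINT x:ball 0 1|lebesgue. trace (T x ** jacobian \<psi> (at x))))"

text \<open>The integral of \<open>f \<circ> T\<close> is taken in the extended sense, so that the estimate contains the
  claim that \<open>f \<circ> T\<close> is integrable.\<close>

definition maximal_gain_of_integrability :: "(real^'n^'n \<Rightarrow> real) \<Rightarrow> bool" where
  "maximal_gain_of_integrability f \<longleftrightarrow> (\<exists>c\<ge>0. \<forall>T g.
     set_integrable lebesgue (ball 0 1) T \<longrightarrow>
     (AE x in lebesgue. x \<in> ball 0 1 \<longrightarrow> T x \<in> Sym_psd) \<longrightarrow>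
     divergence_free T \<longrightarrow>
     has_integrable_normal_trace T g \<longrightarrow>
     (\<integral>\<^sup>+x\<in>ball 0 1. ennreal (f (T x)) \<partial>lebesgue)
       \<le> ennreal (c * (LINT e|sphere_measure. norm (g e))
                        powr (real CARD('n) / (real CARD('n) - 1))))"

end

(* The test tensors are T(x) = r^(-m) (m e (x) e + (d-1-m) I) with r = |x| and e = x / r. They are positive
   semi-definite for m < d - 1, divergence-free also across the origin (the flux through a sphere of
   radius r is of order r^(d-1-m)), and T n = (d-1) n on the unit sphere, independently of m. In polar
   coordinates the integral of f(T) over the ball is (d-1) / (d (d-1-m)) times the spherical integral of
   f(m e (x) e + (d-1-m) I), which gives the estimate; letting m tend to d - 1 (Fatou) makes f vanish at
   almost every, hence every, rank-one tensor.

   The integration by parts behind "divergence-free" rests on the divergence theorem on the sphere. It is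
   obtained by integrating the derivative of a compactly supported function eta(r) phi(e) over the whole
   space, where translation invariance of the Lebesgue measure makes the integral vanish. *)
theory Submission
  imports Defs
begin

section \<open>Polar coordinates\<close>

text \<open>Away from the origin the field r^(-m) (a e (x) e + b I) has divergence (a (d-1-m) - b m)
  r^(-m-1) e, so a = m and b = d-1-m are forced up to a common factor. The eigenvalue along e is
  then a + b = d-1, while the one on the orthogonal complement is d-1-m: the family degenerates to
  rank one as m tends to d-1, and the normal trace does not notice.

  The degree d/(d-1) is critical for this family. By homogeneity f(T) behaves like r^(-m d/(d-1)),
  which stops being integrable over the ball exactly at m = d-1. The gain hypothesis bounds the
  integral over the ball uniformly in m although its radial factor blows up, so the spherical factor
  has to vanish at the rate d-1-m.

  The obstacle is the singularity at the origin, where Gauss's formula cannot be applied to T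
  directly. The integral over the ball is cut into spheres, on which only the C^1 function e ->
  phi(r e) is differentiated, and then into rays, on which the fundamental theorem of calculus asks
  for mere continuity at r = 0.\<close>

lemma space_sphere_measure [simp]: "space sphere_measure = sphere (0::real^'n) 1"
  by (simp add: sphere_measure_def space_scale_measure)

lemma sets_sphere_measure [measurable_cong]:
  "sets sphere_measure = sets (restrict_space borel (sphere (0::real^'n) 1))"
  by (simp add: sphere_measure_def)

lemma measurable_normalize:
  "(\<lambda>x. x /\<^sub>R norm x) \<in> measurable (restrict_space lborel (ball 0 1 - {0}))
     (restrict_space borel (sphere (0::real^'n) 1))"
  by (intro measurable_restrict_space2 measurable_restrict_space1) (auto simp: space_restrict_space)

text \<open>The apex is left out because \<open>x /\<^sub>R norm x\<close> is \<open>0\<close> at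
  the origin, which is not a point of the sphere.\<close>

definition unit_cone :: "(real^'n) set \<Rightarrow> (real^'n) set" where
  "unit_cone B = {x \<in> ball 0 1 - {0}. x /\<^sub>R norm x \<in> B}"

lemma unit_cone_borel:
  fixes B :: "(real^'n) set"
  assumes "B \<in> sets sphere_measure"
  shows "unit_cone B \<in> sets lborel"
proof -
  have "B \<in> sets (restrict_space borel (sphere (0::real^'n) 1))"
    using assms by (simp add: sets_sphere_measure)
  from measurable_sets[OF measurable_normalize this]
  have "(\<lambda>x. x /\<^sub>R norm x) -` B \<inter> (ball 0 1 - {0}) \<in> sets (restrict_space lborel (ball 0 1 - {0}))"
    by (simp add: space_restrict_space)
  also have "(\<lambda>x. x /\<^sub>R norm x) -` B \<inter> (ball 0 1 - {0}) = unit_cone B"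
    by (auto simp: unit_cone_def)
  finally show ?thesis
    using sets_restrict_space_iff[of "ball 0 1 - {0}" "lborel :: (real^'n) measure" "unit_cone B"] by simp
qed

lemma emeasure_sphere_measure:
  fixes B :: "(real^'n) set"
  assumes "B \<in> sets sphere_measure"
  shows "emeasure sphere_measure B = of_nat CARD('n) * emeasure lborel (unit_cone B)"
proof -
  have B: "B \<in> sets (restrict_space borel (sphere (0::real^'n) 1))"
    using assms by (simp add: sets_sphere_measure)
  have "(\<lambda>x. x /\<^sub>R norm x) -` B \<inter> (ball 0 1 - {0}) = unit_cone B"
    and "unit_cone B \<subseteq> ball 0 1 - {0}"
    by (auto simp: unit_cone_def)
  then show ?thesis
    using B unfolding sphere_measure_def
    by (simp add: emeasure_distr[OF measurable_normalize] emeasure_restrict_space space_restrict_space)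
qed

lemma emeasure_unit_cone_finite: "emeasure lborel (unit_cone (B :: (real^'n) set)) < \<infinity>"
proof -
  have "emeasure lborel (unit_cone B) \<le> emeasure lborel (ball 0 1 :: (real^'n) set)"
    by (intro emeasure_mono) (auto simp: unit_cone_def)
  then show ?thesis
    using emeasure_lborel_ball_finite[of "0::real^'n" 1] by (simp add: le_less_trans)
qed

lemma finite_measure_sphere_measure: "finite_measure (sphere_measure :: (real^'n) measure)"
proof (rule finite_measureI)
  have "space (sphere_measure :: (real^'n) measure) \<in> sets sphere_measure" by (rule sets.top)
  from emeasure_sphere_measure[OF this]
  show "emeasure sphere_measure (space (sphere_measure :: (real^'n) measure)) \<noteq> \<infinity>"
    using emeasure_unit_cone_finite[of "space (sphere_measure :: (real^'n) measure)"]
    by (simp add: ennreal_mult_eq_top_iff less_top)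
qed

interpretation sphere_measure: finite_measure "sphere_measure :: (real^'n) measure"
  by (rule finite_measure_sphere_measure)

text \<open>The radial factor of Lebesgue measure on the unit ball. The cut to the unit interval
  sits in the density, so that this remains a measure on all of the reals and measurability is plain
  Borel measurability.\<close>

definition radial_measure :: "nat \<Rightarrow> real measure" where
  "radial_measure n = density lborel (\<lambda>r. ennreal (indicator {0<..<1} r * r ^ (n - 1)))"

lemma sets_radial_measure [measurable_cong, simp]: "sets (radial_measure n) = sets borel"
  by (simp add: radial_measure_def)

lemma space_radial_measure [simp]: "space (radial_measure n) = UNIV"
  by (simp add: radial_measure_def)

lemma nn_integral_radial_measure:
  assumes "F \<in> borel_measurable borel"
  shows "(\<integral>\<^sup>+r. F r \<partial>radial_measure n) =
    (\<integral>\<^sup>+r. ennreal (r ^ (n - 1)) * F r * indicator {0..1} r \<partial>lborel)"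
proof -
  have "AE r in lborel. r \<noteq> (0::real) \<and> r \<noteq> 1"
    using AE_lborel_singleton[of 0] AE_lborel_singleton[of 1] by (auto elim: eventually_elim2)
  then have "AE r in lborel. ennreal (indicator {0<..<1} r * r ^ (n - 1)) * F r =
      ennreal (r ^ (n - 1)) * F r * indicator {0..1} r"
    by (rule eventually_mono) (auto simp: indicator_def)
  then show ?thesis
    unfolding radial_measure_def using assms
    by (subst nn_integral_density) (auto intro: nn_integral_cong_AE)
qed

text \<open>The value \<open>b ^ n\<close> is the ratio of the volumes of a cone truncated at radius
  \<open>b\<close> and at radius 1; this match is what identifies the two measures in
  \<open>distr_polar\<close>.\<close>

lemma emeasure_radial_measure:
  assumes "0 < n" "0 \<le> b" "b \<le> 1"
  shows "of_nat n * emeasure (radial_measure n) {..<b} = ennreal (b ^ n)"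
proof -
  have "emeasure (radial_measure n) {..<b} = (\<integral>\<^sup>+r. indicator {..<b} r \<partial>radial_measure n)"
    by simp
  also have "\<dots> = (\<integral>\<^sup>+r. ennreal (r ^ (n - 1)) * indicator {..<b} r * indicator {0..1} r \<partial>lborel)"
    by (intro nn_integral_radial_measure) simp
  also have "\<dots> = (\<integral>\<^sup>+r. ennreal (r ^ (n - 1)) * indicator {0..b} r \<partial>lborel)"
    using AE_lborel_singleton[of b] assms
    by (intro nn_integral_cong_AE) (auto elim!: eventually_mono split: split_indicator)
  also have "\<dots> = ennreal (b ^ n / n - 0 ^ n / n)"
  proof (rule nn_integral_FTC_Icc)
    fix x :: real
    show "((\<lambda>r. r ^ n / n) has_real_derivative x ^ (n - 1)) (at x)"
      using \<open>0 < n\<close> by (auto intro!: derivative_eq_intros)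
  qed (use assms in auto)
  also have "\<dots> = ennreal (b ^ n / n)" using assms by (simp add: zero_power)
  finally have "of_nat n * emeasure (radial_measure n) {..<b} = ennreal (real n * (b ^ n / n))"
    using assms by (simp only: ennreal_of_nat_eq_real_of_nat ennreal_mult' of_nat_0_le_iff)
  then show ?thesis
    using assms by simp
qed

lemma finite_measure_radial_measure: "0 < n \<Longrightarrow> finite_measure (radial_measure n)"
proof (rule finite_measureI)
  assume "0 < n"
  have "emeasure (radial_measure n) (space (radial_measure n)) = (\<integral>\<^sup>+r. 1 \<partial>radial_measure n)"
    by simp
  also have "\<dots> = (\<integral>\<^sup>+r. ennreal (r ^ (n - 1)) * 1 * indicator {0..1} r \<partial>lborel)"
    by (intro nn_integral_radial_measure) simp
  also have "\<dots> \<le> (\<integral>\<^sup>+(r::real). indicator {0..1} r \<partial>lborel)"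
    by (intro nn_integral_mono) (auto simp: indicator_def intro!: power_le_one)
  also have "\<dots> < \<infinity>" by simp
  finally show "emeasure (radial_measure n) (space (radial_measure n)) \<noteq> \<infinity>" by simp
qed

text \<open>For \<open>b > 0\<close>, truncating at radius \<open>b\<close> amounts to dilating the
  cone by \<open>b\<close>, which multiplies volumes by the d-th power of \<open>b\<close>. For
  \<open>b = 0\<close> the truncated cone is empty and both sides are 0.\<close>

lemma emeasure_truncated_unit_cone:
  assumes "0 \<le> b" "b \<le> 1" "B \<in> sets sphere_measure"
  shows "emeasure lborel {x \<in> unit_cone B. norm x < b} =
    ennreal (b ^ CARD('n)) * emeasure lborel (unit_cone (B :: (real^'n) set))"
proof (cases "b = 0")
  case False
  have "{x \<in> unit_cone B. norm x < b} = (\<lambda>x. b *\<^sub>R x + 0) ` unit_cone B"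
  proof (intro subset_antisym subsetI)
    fix x assume x: "x \<in> {x \<in> unit_cone B. norm x < b}"
    then have "x = b *\<^sub>R (x /\<^sub>R b) + 0" "x /\<^sub>R b \<in> unit_cone B"
      using assms False by (auto simp: unit_cone_def field_simps)
    then show "x \<in> (\<lambda>x. b *\<^sub>R x + 0) ` unit_cone B" by (rule image_eqI)
  next
    fix y assume "y \<in> (\<lambda>x. b *\<^sub>R x + 0) ` unit_cone B"
    then obtain x where x: "x \<in> unit_cone B" "y = b *\<^sub>R x" by auto
    then have "b * norm x < b" using assms False by (simp add: unit_cone_def)
    moreover from this have "b * norm x < 1" using assms by simp
    ultimately show "y \<in> {x \<in> unit_cone B. norm x < b}"
      using x assms False by (auto simp: unit_cone_def field_simps)
  qed
  moreover have "{x \<in> unit_cone B. norm x < b} \<in> sets lborel"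
    using unit_cone_borel[OF assms(3)] by simp
  \<comment> \<open>The scaling rule \<open>emeasure_lebesgue_affine\<close> speaks of
    \<open>lebesgue\<close>; on Borel sets its completion changes nothing.\<close>
  moreover have "emeasure lebesgue X = emeasure lborel X" if "X \<in> sets lborel" for X :: "(real^'n) set"
    using that by simp
  ultimately have "emeasure lborel {x \<in> unit_cone B. norm x < b} =
      ennreal \<bar>b\<bar> ^ CARD('n) * emeasure lborel (unit_cone B)"
    using emeasure_lebesgue_affine[of b 0 "unit_cone B"] unit_cone_borel[OF assms(3)]
    by (simp only: DIM_cart DIM_real mult_1_right ennreal_power abs_ge_zero)
  then show ?thesis
    using assms(1) by (simp only: ennreal_power abs_of_nonneg)
qed simp

lemma measurable_polar:
  "(\<lambda>x. (norm x, x /\<^sub>R norm x)) \<in> measurable (restrict_space lborel (ball 0 1 - {0}))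
     (radial_measure n \<Otimes>\<^sub>M (sphere_measure :: (real^'n) measure))"
  using measurable_normalize
  by (intro measurable_Pair) (auto intro!: measurable_restrict_space1
    simp: o_def measurable_cong_sets[OF refl sets_radial_measure] measurable_cong_sets[OF refl sets_sphere_measure])

text \<open>By sigma-finiteness it is enough to compare the two sides on rectangles
  \<open>A \<times> B\<close>. With \<open>B\<close> fixed, both are measures in \<open>A\<close>,
  so comparing them on the half-lines \<open>{..<a}\<close> suffices, and there the claim is the
  dilation law for cones.\<close>

theorem distr_polar:
  "distr (restrict_space lborel (ball 0 1 - {0})) (radial_measure CARD('n) \<Otimes>\<^sub>M sphere_measure)
     (\<lambda>x. (norm x, x /\<^sub>R norm x)) = radial_measure CARD('n) \<Otimes>\<^sub>M (sphere_measure :: (real^'n) measure)"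
  (is "distr ?R ?N ?P = ?N")
proof (rule pair_measure_eqI[symmetric])
  interpret R: finite_measure "radial_measure CARD('n)" by (rule finite_measure_radial_measure) simp
  show "sigma_finite_measure (radial_measure CARD('n))" ..
  show "sigma_finite_measure (sphere_measure :: (real^'n) measure)" ..
  note P = measurable_polar[of "CARD('n)", where 'n='n]
  fix A :: "real set" and B :: "(real^'n) set"
  assume A: "A \<in> sets (radial_measure CARD('n))" and B: "B \<in> sets sphere_measure"
  have C: "unit_cone B \<in> sets borel" using unit_cone_borel[OF B] by simp
  define M where "M = distr (restrict_space lborel (unit_cone B)) borel norm"
  have M: "emeasure M X = emeasure lborel {x \<in> unit_cone B. norm x \<in> X}" if "X \<in> sets borel" for X
  proof -
    have m: "norm \<in> measurable (restrict_space lborel (unit_cone B)) borel"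
      by (intro measurable_restrict_space1) simp
    have "norm -` X \<inter> space (restrict_space lborel (unit_cone B)) = {x \<in> unit_cone B. norm x \<in> X}"
      by (auto simp: space_restrict_space)
    then show ?thesis
      using that C by (simp add: M_def emeasure_distr[OF m] emeasure_restrict_space Collect_subset)
  qed
  have "M = scale_measure (emeasure sphere_measure B) (radial_measure CARD('n))"
  proof (rule measure_eqI_generator_eq[where E="range lessThan" and A="\<lambda>i. {..<real i}" and \<Omega>=UNIV])
    show "Int_stable (range lessThan :: real set set)"
      by (auto intro!: Int_stableI simp: greaterThan_Int_greaterThan simp del: lessThan_def)
    show "sets M = sigma_sets UNIV (range lessThan)"
      by (simp add: M_def borel_Iio sets_measure_of_conv)
    show "sets (scale_measure (emeasure sphere_measure B) (radial_measure CARD('n))) = sigma_sets UNIV (range lessThan)"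
      by (simp add: borel_Iio sets_measure_of_conv)
    show "(\<Union>i. {..<real i}) = UNIV"
      using reals_Archimedean2 by auto
    show "emeasure M {..<real i} \<noteq> \<infinity>" for i
    proof -
      have "emeasure lborel {x \<in> unit_cone B. norm x < real i} \<le> emeasure lborel (unit_cone B)"
        using C by (intro emeasure_mono) auto
      also have "\<dots> < \<infinity>" by (rule emeasure_unit_cone_finite)
      finally show ?thesis using M[of "{..<real i}"] by simp
    qed
    fix X assume "X \<in> range (lessThan :: real \<Rightarrow> _)"
    then obtain a where X: "X = {..<a}" by auto
    \<comment> \<open>Points of the cone have norm strictly between 0 and 1, so the threshold may be
      clamped to the unit interval, where the dilation law applies.\<close>
    define b where "b = max 0 (min a 1)"
    have b: "0 \<le> b" "b \<le> 1" by (auto simp: b_def)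
    have "emeasure M X = emeasure lborel {x \<in> unit_cone B. norm x < a}"
      using M[of "{..<a}"] X by simp
    also have "{x \<in> unit_cone B. norm x < a} = {x \<in> unit_cone B. norm x < b}"
    proof -
      have "norm x < a \<longleftrightarrow> norm x < b" if "x \<in> unit_cone B" for x
        using that by (auto simp: b_def unit_cone_def less_max_iff_disj)
      then show ?thesis by (intro Collect_cong conj_cong refl)
    qed
    also have "emeasure lborel \<dots> = ennreal (b ^ CARD('n)) * emeasure lborel (unit_cone B)"
      by (rule emeasure_truncated_unit_cone[OF b B])
    also have "ennreal (b ^ CARD('n)) = of_nat CARD('n) * emeasure (radial_measure CARD('n)) {..<b}"
      by (rule emeasure_radial_measure[symmetric]) (use b in auto)
    also have "emeasure (radial_measure CARD('n)) {..<b} = emeasure (radial_measure CARD('n)) {..<a}"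
    proof -
      have "ennreal (indicator {0<..<1} r * r ^ (CARD('n) - 1)) * indicator {..<b} r =
          ennreal (indicator {0<..<1} r * r ^ (CARD('n) - 1)) * indicator {..<a} r" for r :: real
        by (auto simp: b_def indicator_def)
      then show ?thesis
        unfolding radial_measure_def
        by (subst (1 2) emeasure_density) simp_all
    qed
    finally have "emeasure M X = of_nat CARD('n) * emeasure (radial_measure CARD('n)) {..<a} * emeasure lborel (unit_cone B)" .
    then show "emeasure M X = emeasure (scale_measure (emeasure sphere_measure B) (radial_measure CARD('n))) X"
      unfolding X emeasure_scale_measure emeasure_sphere_measure[OF B] by (simp only: ac_simps)
  qed (simp_all add: image_subset_iff)
  then have "emeasure sphere_measure B * emeasure (radial_measure CARD('n)) A = emeasure lborel {x \<in> unit_cone B. norm x \<in> A}"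
    using M[of A] A by simp
  moreover have "?P -` (A \<times> B) \<inter> space ?R = {x \<in> unit_cone B. norm x \<in> A}"
    by (auto simp: unit_cone_def space_restrict_space)
  moreover have "{x \<in> unit_cone B. norm x \<in> A} \<subseteq> ball 0 1 - {0}" by (auto simp: unit_cone_def)
  ultimately show "emeasure (radial_measure CARD('n)) A * emeasure sphere_measure B = emeasure (distr ?R ?N ?P) (A \<times> B)"
  proof -
    assume a: "emeasure sphere_measure B * emeasure (radial_measure CARD('n)) A = emeasure lborel {x \<in> unit_cone B. norm x \<in> A}"
      and b: "?P -` (A \<times> B) \<inter> space ?R = {x \<in> unit_cone B. norm x \<in> A}"
      and c: "{x \<in> unit_cone B. norm x \<in> A} \<subseteq> ball 0 1 - {0}"
    have "emeasure (distr ?R ?N ?P) (A \<times> B) = emeasure ?R (?P -` (A \<times> B) \<inter> space ?R)"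
      using A B by (intro emeasure_distr P pair_measureI)
    also have "\<dots> = emeasure lborel {x \<in> unit_cone B. norm x \<in> A}"
      unfolding b using c by (intro emeasure_restrict_space) auto
    finally show ?thesis using a by (simp only: mult.commute)
  qed
qed (simp only: sets_distr)

section \<open>Integration in polar coordinates\<close>

lemma integrable_sphere_measure:
  fixes h :: "real^'n \<Rightarrow> 'b::{banach, second_countable_topology}"
  assumes "continuous_on (sphere 0 1) h"
  shows "integrable sphere_measure h"
proof -
  have "bounded (h ` sphere 0 1)"
    using assms by (intro compact_imp_bounded compact_continuous_image) auto
  then obtain C where C: "\<And>e. e \<in> sphere 0 1 \<Longrightarrow> norm (h e) \<le> C"
    unfolding bounded_iff by blast
  have "h \<in> borel_measurable sphere_measure"
    using borel_measurable_continuous_on_restrict[OF assms]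
    by (simp add: measurable_cong_sets[OF sets_sphere_measure refl])
  moreover have "AE e in sphere_measure. norm (h e) \<le> C"
    by (rule AE_I2) (use C in auto)
  ultimately show ?thesis
    by (rule sphere_measure.integrable_const_bound[rotated])
qed

lemma id_borel_measurable_sphere_measure [measurable]:
  "(\<lambda>e. e) \<in> borel_measurable (sphere_measure :: (real^'n) measure)"
  by (simp add: measurable_cong_sets[OF sets_sphere_measure refl] measurable_restrict_space1)

lemma measurable_scaleR_polar:
  assumes "F \<in> borel_measurable borel"
  shows "(\<lambda>(r, e). F (r *\<^sub>R e)) \<in> borel_measurable (radial_measure n \<Otimes>\<^sub>M (sphere_measure :: (real^'n) measure))"
proof -
  have "(\<lambda>p. fst p *\<^sub>R snd p) \<in> borel_measurable (radial_measure n \<Otimes>\<^sub>M (sphere_measure :: (real^'n) measure))"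
  proof (intro borel_measurable_scaleR)
    show "fst \<in> borel_measurable (radial_measure n \<Otimes>\<^sub>M (sphere_measure :: (real^'n) measure))"
      using measurable_fst[of "radial_measure n" "sphere_measure :: (real^'n) measure"]
      by (simp add: measurable_cong_sets[OF refl sets_radial_measure])
    show "snd \<in> borel_measurable (radial_measure n \<Otimes>\<^sub>M (sphere_measure :: (real^'n) measure))"
      using measurable_compose[OF measurable_snd id_borel_measurable_sphere_measure] by simp
  qed
  from measurable_compose[OF this assms] show ?thesis
    by (simp add: case_prod_beta')
qed

lemma AE_radial_measure: "AE r in radial_measure n. 0 < r \<and> r < 1"
  unfolding radial_measure_def by (subst AE_density) (auto simp: indicator_def split: if_splits)

lemma nn_integral_polar:
  fixes F :: "real^'n \<Rightarrow> ennreal"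
  assumes [measurable]: "F \<in> borel_measurable borel"
  shows "(\<integral>\<^sup>+x\<in>ball 0 1. F x \<partial>lborel) =
    (\<integral>\<^sup>+r. \<integral>\<^sup>+e. F (r *\<^sub>R e) \<partial>sphere_measure \<partial>radial_measure CARD('n))"
proof -
  have "AE x in lborel. x \<noteq> (0 :: real^'n)" by (rule AE_lborel_singleton)
  then have "(\<integral>\<^sup>+x\<in>ball 0 1. F x \<partial>lborel) = (\<integral>\<^sup>+x\<in>ball 0 1 - {0}. F x \<partial>lborel)"
    by (intro nn_integral_cong_AE) (auto elim!: eventually_mono simp: indicator_def)
  also have "\<dots> = (\<integral>\<^sup>+x. F x \<partial>restrict_space lborel (ball 0 1 - {0}))"
    by (simp add: nn_integral_restrict_space)
  also have "\<dots> = (\<integral>\<^sup>+x. (case (norm x, x /\<^sub>R norm x) of (r, e) \<Rightarrow> F (r *\<^sub>R e)) \<partial>restrict_space lborel (ball 0 1 - {0}))"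
    by (intro nn_integral_cong) (simp add: space_restrict_space)
  also have "\<dots> = (\<integral>\<^sup>+p. (case p of (r, e) \<Rightarrow> F (r *\<^sub>R e)) \<partial>(distr (restrict_space lborel (ball 0 1 - {0})) (radial_measure CARD('n) \<Otimes>\<^sub>M sphere_measure) (\<lambda>x. (norm x, x /\<^sub>R norm x))))"
    by (rule nn_integral_distr[OF measurable_polar, symmetric]) measurable
  also have "\<dots> = (\<integral>\<^sup>+p. (case p of (r, e) \<Rightarrow> F (r *\<^sub>R e)) \<partial>(radial_measure CARD('n) \<Otimes>\<^sub>M sphere_measure))"
    by (simp only: distr_polar)
  also have "\<dots> = (\<integral>\<^sup>+r. \<integral>\<^sup>+e. F (r *\<^sub>R e) \<partial>sphere_measure \<partial>radial_measure CARD('n))"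
    using measurable_scaleR_polar[OF assms] by (subst sphere_measure.nn_integral_fst[symmetric]) simp_all
  finally show ?thesis .
qed

lemma
  fixes F :: "real^'n \<Rightarrow> real"
  assumes [measurable]: "F \<in> borel_measurable borel"
  shows integrable_polar_iff: "set_integrable lborel (ball 0 1) F \<longleftrightarrow>
      integrable (radial_measure CARD('n) \<Otimes>\<^sub>M sphere_measure) (\<lambda>(r, e). F (r *\<^sub>R e))" (is ?I)
    and lebesgue_integral_polar: "(LINT x:ball 0 1|lborel. F x) =
      (LINT p|(radial_measure CARD('n) \<Otimes>\<^sub>M sphere_measure). (case p of (r, e) \<Rightarrow> F (r *\<^sub>R e)))" (is ?L)
proof -
  let ?R = "restrict_space lborel (ball 0 1 - {0 :: real^'n})"
  have "(\<lambda>x. indicator S x *\<^sub>R F x) \<in> borel_measurable lborel" if "S \<in> sets borel" for S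
    using that assms by (intro borel_measurable_scaleR borel_measurable_indicator) simp_all
  note m = this[of "ball 0 1"] this[of "ball 0 1 - {0}"]
  have ae: "AE x in lborel. indicator (ball 0 1) x *\<^sub>R F x = indicator (ball 0 1 - {0}) x *\<^sub>R F x"
    using AE_lborel_singleton[of "0 :: real^'n"] by eventually_elim (auto simp: indicator_def)
  have *: "(case (norm x, x /\<^sub>R norm x) of (r, e) \<Rightarrow> F (r *\<^sub>R e)) = F x" if "x \<in> space ?R" for x
    using that by (simp add: space_restrict_space)
  have "set_integrable lborel (ball 0 1) F \<longleftrightarrow> integrable ?R F"
    unfolding set_integrable_def
    using m by (subst integrable_cong_AE[OF _ _ ae]) (auto simp: integrable_restrict_space)
  also have "\<dots> \<longleftrightarrow> integrable ?R (\<lambda>x. (case (norm x, x /\<^sub>R norm x) of (r, e) \<Rightarrow> F (r *\<^sub>R e)))"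
    by (intro Bochner_Integration.integrable_cong refl * [symmetric])
  also have "\<dots> \<longleftrightarrow> integrable (radial_measure CARD('n) \<Otimes>\<^sub>M sphere_measure) (\<lambda>(r, e). F (r *\<^sub>R e))"
    by (subst integrable_distr_eq[OF measurable_polar, of _ "CARD('n)", symmetric]) (measurable, simp only: distr_polar)
  finally show ?I .
  have "(LINT x:ball 0 1|lborel. F x) = (LINT x|?R. F x)"
    unfolding set_lebesgue_integral_def
    using m by (subst integral_cong_AE[OF _ _ ae]) (auto simp: integral_restrict_space)
  also have "\<dots> = (LINT x|?R. (case (norm x, x /\<^sub>R norm x) of (r, e) \<Rightarrow> F (r *\<^sub>R e)))"
    by (intro Bochner_Integration.integral_cong refl * [symmetric])
  also have "\<dots> = (LINT p|(radial_measure CARD('n) \<Otimes>\<^sub>M sphere_measure). (case p of (r, e) \<Rightarrow> F (r *\<^sub>R e)))"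
    by (subst integral_distr[OF measurable_polar, of _ "CARD('n)", symmetric]) (measurable, simp only: distr_polar)
  finally show ?L .
qed

text \<open>Both orders of integration serve in \<open>ball_divergence\<close>: spheres inside for
  the exchange of tangential derivatives, rays inside for the radial primitive.\<close>

lemma
  fixes F :: "real^'n \<Rightarrow> real"
  assumes F [measurable]: "F \<in> borel_measurable borel" and int: "set_integrable lborel (ball 0 1) F"
  shows integral_polar_radial_outer: "(LINT x:ball 0 1|lborel. F x) =
      (LINT r|radial_measure CARD('n). LINT e|sphere_measure. F (r *\<^sub>R e))"
    and integral_polar_sphere_outer: "(LINT x:ball 0 1|lborel. F x) =
      (LINT e|sphere_measure. LINT r|radial_measure CARD('n). F (r *\<^sub>R e))"
proof -
  interpret R: finite_measure "radial_measure CARD('n)" by (rule finite_measure_radial_measure) simp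
  interpret pair_sigma_finite "radial_measure CARD('n)" "sphere_measure :: (real^'n) measure" ..
  have i: "integrable (radial_measure CARD('n) \<Otimes>\<^sub>M sphere_measure) (\<lambda>(r, e :: real^'n). F (r *\<^sub>R e))"
    using int integrable_polar_iff[OF F] by simp
  show "(LINT x:ball 0 1|lborel. F x) =
      (LINT r|radial_measure CARD('n). LINT e|sphere_measure. F (r *\<^sub>R e))"
    using integral_fst'[OF i] lebesgue_integral_polar[OF F] by simp
  show "(LINT x:ball 0 1|lborel. F x) =
      (LINT e|sphere_measure. LINT r|radial_measure CARD('n). F (r *\<^sub>R e))"
    using integral_snd[OF i] lebesgue_integral_polar[OF F] by simp
qed

lemma
  fixes F :: "real \<Rightarrow> real"
  assumes [measurable]: "F \<in> borel_measurable borel"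
  shows integral_radial_measure:
      "(LINT r|radial_measure n. F r) = (LINT r:{0..1}|lborel. r ^ (n - 1) * F r)" (is ?L)
    and integrable_radial_measure_iff:
      "integrable (radial_measure n) F \<longleftrightarrow> set_integrable lborel {0..1} (\<lambda>r. r ^ (n - 1) * F r)" (is ?I)
proof -
  have ae: "AE r in lborel. (indicator {0<..<1} r * r ^ (n - 1)) * F r = indicator {0..1} r *\<^sub>R (r ^ (n - 1) * F r)"
    using AE_lborel_singleton[of "0::real"] AE_lborel_singleton[of "1::real"]
    by eventually_elim (auto simp: indicator_def)
  from ae show ?L
    unfolding radial_measure_def set_lebesgue_integral_def
    by (subst integral_density) (auto intro!: integral_cong_AE simp: indicator_def)
  from ae show ?I
    unfolding radial_measure_def set_integrable_def
    by (subst integrable_density, simp, simp, simp add: indicator_def)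
      (intro integrable_cong_AE, auto elim: eventually_mono)
qed

lemma nn_integral_powr_radial_measure:
  assumes "0 < n" "a < real n"
  shows "(\<integral>\<^sup>+r. ennreal (r powr (- a)) \<partial>radial_measure n) = ennreal (1 / (real n - a))"
proof -
  have "((\<lambda>r. r powr (real n - 1 - a)) has_integral 1 powr (real n - a) / (real n - a) - 0 powr (real n - a) / (real n - a)) {0..1::real}"
  \<comment> \<open>The primitive may fail to be differentiable at 0, when its exponent is below 1.
    It is continuous there because \<open>a < real n\<close>, and its value at 0 is 0.\<close>
  proof (rule fundamental_theorem_of_calculus_interior)
    show "continuous_on {0..1} (\<lambda>r::real. r powr (real n - a) / (real n - a))"
      using assms by (intro continuous_intros continuous_on_powr') auto
    show "((\<lambda>r. r powr (real n - a) / (real n - a)) has_vector_derivative x powr (real n - 1 - a)) (at x)"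
      if "x \<in> {0<..<1}" for x :: real
      using that assms unfolding has_real_derivative_iff_has_vector_derivative[symmetric]
      by (auto intro!: derivative_eq_intros simp: diff_diff_eq add.commute)
  qed simp
  then have "((\<lambda>r. indicator {0..1} r * r powr (real n - 1 - a)) has_integral 1 / (real n - a)) UNIV"
    using assms by (subst (asm) has_integral_restrict_UNIV[symmetric]) (simp add: indicator_def of_bool_def if_distrib if_distribR cong: if_cong)
  then have "(\<integral>\<^sup>+r. ennreal (indicator {0..1} r * r powr (real n - 1 - a)) \<partial>lborel) = ennreal (1 / (real n - a))"
    by (intro nn_integral_has_integral_lborel) auto
  moreover have "(\<integral>\<^sup>+r. ennreal (r powr (- a)) \<partial>radial_measure n) = (\<integral>\<^sup>+r. ennreal (indicator {0..1} r * r powr (real n - 1 - a)) \<partial>lborel)"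
  proof -
    have "(\<integral>\<^sup>+r. ennreal (r powr (- a)) \<partial>radial_measure n) =
        (\<integral>\<^sup>+r. ennreal (r ^ (n - 1)) * ennreal (r powr (- a)) * indicator {0..1} r \<partial>lborel)"
      by (rule nn_integral_radial_measure) simp
    also have "\<dots> = (\<integral>\<^sup>+r. ennreal (indicator {0..1} r * r powr (real n - 1 - a)) \<partial>lborel)"
    proof (rule nn_integral_cong_AE, use AE_lborel_singleton[of "0::real"] in eventually_elim)
      fix r :: real assume "r \<noteq> 0"
      show "ennreal (r ^ (n - 1)) * ennreal (r powr (- a)) * indicator {0..1} r =
          ennreal (indicator {0..1} r * r powr (real n - 1 - a))"
      proof (cases "r \<in> {0..1}")
        case True
        then have "r ^ (n - 1) * r powr (- a) = r powr (real n - 1 - a)"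
          using \<open>r \<noteq> 0\<close> \<open>0 < n\<close> by (simp add: powr_realpow[symmetric] powr_add[symmetric] of_nat_diff)
        then show ?thesis using True by (simp add: ennreal_mult'[symmetric])
      qed simp
    qed
    finally show ?thesis .
  qed
  ultimately show ?thesis by simp
qed

section \<open>The divergence theorem on the sphere\<close>

lemma has_real_derivative_along_line:
  assumes "(u has_derivative u') (at (x + t *\<^sub>R v))"
  shows "((\<lambda>t. u (x + t *\<^sub>R v) :: real) has_real_derivative u' v) (at t)"
proof -
  have "((\<lambda>t. x + t *\<^sub>R v) has_derivative (\<lambda>s. s *\<^sub>R v)) (at t)"
    by (auto intro!: derivative_eq_intros)
  from has_derivative_compose[OF this assms] show ?thesis
    using linear_scale[OF has_derivative_linear[OF assms]]
    by (simp add: has_field_derivative_def mult_commute_abs)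
qed

text \<open>Difference quotients in the direction \<open>v\<close> have integral 0 by translation
  invariance. The mean value theorem bounds them by \<open>L\<close> on a fixed ball, so dominated
  convergence carries the 0 over to the derivative, whose measurability comes from being their
  pointwise limit.\<close>

lemma integral_directional_derivative_eq_0:
  fixes u :: "'a::euclidean_space \<Rightarrow> real"
  assumes der: "\<And>x. (u has_derivative u' x) (at x)"
    and supp: "\<And>x. R \<le> norm x \<Longrightarrow> u x = 0"
    and bound: "\<And>x. \<bar>u' x v\<bar> \<le> L"
  shows "integrable lborel (\<lambda>x. u' x v)" "(LINT x|lborel. u' x v) = 0"
proof -
  have cont: "continuous_on UNIV u"
    using has_derivative_continuous[OF der] by (simp add: continuous_on_eq_continuous_at)
  then have [measurable]: "u \<in> borel_measurable borel"
    by (rule borel_measurable_continuous_onI)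
  have int_u: "integrable lborel u"
  proof -
    have "integrable lborel (\<lambda>x. indicator (cball 0 R) x *\<^sub>R u x)"
      by (intro borel_integrable_compact continuous_on_subset[OF cont]) auto
    also have "(\<lambda>x. indicator (cball 0 R) x *\<^sub>R u x) = u"
      using supp by (fastforce simp: indicator_def fun_eq_iff)
    finally show ?thesis .
  qed
  define s where "s n x = real (Suc n) * (u (x + v /\<^sub>R real (Suc n)) - u x)" for n x
  have int_s: "integrable lborel (\<lambda>x. u (x + w))" "(LINT x|lborel. u (x + w)) = (LINT x|lborel. u x)" for w
  proof -
    have "integrable (distr lborel borel ((+) w)) u" using int_u by (simp add: lborel_distr_plus)
    then show "integrable lborel (\<lambda>x. u (x + w))"
      by (subst (asm) integrable_distr_eq) (simp_all add: add.commute)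
    have "(LINT x|distr lborel borel ((+) w). u x) = (LINT x|lborel. u (w + x))"
      by (rule integral_distr) auto
    then show "(LINT x|lborel. u (x + w)) = (LINT x|lborel. u x)"
      by (simp add: lborel_distr_plus add.commute)
  qed
  have s0: "(LINT x|lborel. s n x) = 0" for n
    unfolding s_def
    by (simp only: integral_mult_right_zero Bochner_Integration.integral_diff[OF int_s(1) int_u] int_s(2)
      diff_self mult_zero_right)
  have lim: "(\<lambda>n. s n x) \<longlonglongrightarrow> u' x v" for x
  proof -
    have "((\<lambda>t. u (x + t *\<^sub>R v)) has_real_derivative u' x v) (at 0)"
      by (rule has_real_derivative_along_line) (simp add: der)
    then have "((\<lambda>t. (u (x + t *\<^sub>R v) - u x) / t) \<longlongrightarrow> u' x v) (at 0)"
      by (simp add: DERIV_def)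
    moreover have "filterlim (\<lambda>n. inverse (real (Suc n))) (at 0) sequentially"
      using LIMSEQ_inverse_real_of_nat by (simp add: filterlim_at)
    ultimately have "((\<lambda>n. (u (x + inverse (real (Suc n)) *\<^sub>R v) - u x) / inverse (real (Suc n))) \<longlongrightarrow> u' x v) sequentially"
      by (rule filterlim_compose)
    then show ?thesis by (simp add: s_def field_simps)
  qed
  \<comment> \<open>The shifts are never longer than \<open>v\<close>, so every quotient vanishes
    outside the support radius enlarged by \<open>norm v\<close>; one dominating function serves all
    \<open>n\<close>.\<close>
  have sb: "\<bar>s n x\<bar> \<le> L * indicator (ball 0 (R + norm v)) x" for n x
  proof (cases "x \<in> ball 0 (R + norm v)")
    case False
    have "norm (v /\<^sub>R real (Suc n)) \<le> norm v" by (simp add: field_simps mult_le_cancel_left1)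
    moreover have "norm x \<le> norm (x + v /\<^sub>R real (Suc n)) + norm (v /\<^sub>R real (Suc n))"
      by (metis add_diff_cancel_right' norm_triangle_ineq4)
    ultimately show ?thesis
      using False supp[of x] supp[of "x + v /\<^sub>R real (Suc n)"] norm_ge_zero[of v] by (simp add: s_def)
  next
    case True
    define c where "c = inverse (real (Suc n))"
    have "\<exists>z. 0 < z \<and> z < c \<and> u (x + c *\<^sub>R v) - u (x + 0 *\<^sub>R v) = (c - 0) * u' (x + z *\<^sub>R v) v"
    proof (rule MVT2)
      fix t
      show "((\<lambda>t. u (x + t *\<^sub>R v)) has_real_derivative u' (x + t *\<^sub>R v) v) (at t)"
        by (rule has_real_derivative_along_line) (rule der)
    qed (simp add: c_def)
    then obtain z where z: "u (x + c *\<^sub>R v) - u x = c * u' (x + z *\<^sub>R v) v" by auto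
    have "s n x = (real (Suc n) * c) * u' (x + z *\<^sub>R v) v"
      using z by (simp only: s_def c_def mult.assoc)
    also have "real (Suc n) * c = 1" by (simp add: c_def)
    finally have "s n x = u' (x + z *\<^sub>R v) v" by simp
    then show ?thesis using True bound by simp
  qed
  have w: "integrable lborel (\<lambda>x::'a. L * indicator (ball 0 (R + norm v)) x :: real)"
    using emeasure_lborel_ball_finite[of "0::'a" "R + norm v"] 
    by (intro integrable_mult_right integrable_real_indicator) simp_all
  have sm: "s n \<in> borel_measurable lborel" for n unfolding s_def by measurable
  have um: "(\<lambda>x. u' x v) \<in> borel_measurable lborel"
    by (rule borel_measurable_LIMSEQ_real[OF lim sm])
  show "integrable lborel (\<lambda>x. u' x v)"
    by (rule integrable_dominated_convergence[where s=s, OF um _ w]) (use sm lim sb in auto)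
  have "(\<lambda>n. LINT x|lborel. s n x) \<longlonglongrightarrow> (LINT x|lborel. u' x v)"
    by (rule integral_dominated_convergence[where s=s, OF um _ w]) (use sm lim sb in auto)
  then show "(LINT x|lborel. u' x v) = 0"
    by (simp add: s0 LIMSEQ_const_iff)
qed

text \<open>Squaring removes the corner of \<open>max 0\<close> at 0: the difference quotient there
  is at most \<open>\<bar>h\<bar>\<close> in absolute value.\<close>

lemma has_real_derivative_max_0_power2:
  "((\<lambda>t::real. (max 0 t)\<^sup>2) has_real_derivative 2 * max 0 t) (at t)"
proof -
  consider "t < 0" | "t = 0" | "0 < t" by linarith
  then show ?thesis
  proof cases
    case 1
    have "((\<lambda>t::real. 0) has_real_derivative 0) (at t)" by simp
    then show ?thesis
      using 1 by (subst DERIV_cong_ev[OF refl _ refl, where g="\<lambda>_. 0"])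
        (auto intro: eventually_mono[OF eventually_nhds_in_open[of "{..<0}"]])
  next
    case 2
    have "((\<lambda>h::real. (max 0 h)\<^sup>2 / h) \<longlongrightarrow> 0) (at 0)"
    proof (rule Lim_null_comparison)
      show "\<forall>\<^sub>F h in at 0. norm ((max 0 h)\<^sup>2 / h) \<le> \<bar>h::real\<bar>"
        by (intro always_eventually) (auto simp: max_def power2_eq_square)
      show "((\<lambda>h::real. \<bar>h\<bar>) \<longlongrightarrow> 0) (at 0)" by (intro tendsto_eq_intros) auto
    qed
    then show ?thesis using 2 by (simp add: DERIV_def)
  next
    case 3
    have "((\<lambda>t::real. t\<^sup>2) has_real_derivative 2 * t) (at t)" by (auto intro!: derivative_eq_intros)
    then show ?thesis
      using 3 by (subst DERIV_cong_ev[OF refl _ refl, where g="\<lambda>t. t\<^sup>2"])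
        (auto intro: eventually_mono[OF eventually_nhds_in_open[of "{0<..}"]])
  qed
qed

text \<open>A \<open>C\<^sup>1\<close> cutoff is enough, and it vanishes near \<open>0\<close> so that the extension
  \<open>bump (norm x) * \<phi> (x /\<^sub>R norm x)\<close> is differentiable at the origin.\<close>

definition bump :: "real \<Rightarrow> real" where
  "bump r = (max 0 ((r - 1/4) * (3/4 - r)))\<^sup>2"

definition bump' :: "real \<Rightarrow> real" where
  "bump' r = 2 * max 0 ((r - 1/4) * (3/4 - r)) * (1 - 2 * r)"

lemma bump_deriv: "(bump has_real_derivative bump' r) (at r)"
proof -
  have "((\<lambda>r. (r - 1/4) * (3/4 - r)) has_real_derivative (1 - 2 * r)) (at r)"
    by (auto intro!: derivative_eq_intros simp: algebra_simps)
  from DERIV_chain2[OF has_real_derivative_max_0_power2 this] show ?thesis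
    unfolding bump_def bump'_def by simp
qed

lemma bump_eq_0:
  assumes "r \<le> 1/4 \<or> 3/4 \<le> r"
  shows "bump r = 0" "bump' r = 0"
proof -
  have "(r - 1/4) * (3/4 - r) \<le> 0" using assms by (auto simp: mult_le_0_iff)
  then show "bump r = 0" "bump' r = 0" by (auto simp: bump_def bump'_def)
qed

lemma bump_pos: "1/4 < r \<Longrightarrow> r < 3/4 \<Longrightarrow> 0 < bump r"
  by (simp add: bump_def)

lemma continuous_on_bump: "continuous_on S bump" "continuous_on S bump'"
  unfolding bump_def[abs_def] bump'_def[abs_def] by (intro continuous_intros)+

lemma bump_bounds: "\<bar>bump r\<bar> \<le> 1" "\<bar>bump' r\<bar> \<le> 2"
proof -
  have "(r - 1/4) * (3/4 - r) = 1/16 - (r - 1/2)\<^sup>2"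
    by (simp add: power2_eq_square field_simps)
  then have q: "0 \<le> max 0 ((r - 1/4) * (3/4 - r))" "max 0 ((r - 1/4) * (3/4 - r)) \<le> 1"
    using zero_le_power2[of "r - 1/2"] by linarith+
  show "\<bar>bump r\<bar> \<le> 1" unfolding bump_def using q by (simp add: power_le_one)
  show "\<bar>bump' r\<bar> \<le> 2"
  proof (cases "r \<le> 1/4 \<or> 3/4 \<le> r")
    case False
    then have "\<bar>1 - 2 * r\<bar> \<le> 1" by auto
    then have "max 0 ((r - 1/4) * (3/4 - r)) * \<bar>1 - 2 * r\<bar> \<le> 1 * 1"
      using q by (intro mult_mono) auto
    then show ?thesis unfolding bump'_def using q by (simp add: abs_mult)
  qed (simp add: bump_eq_0)
qed

text \<open>The cutoff varies only radially and the factor in \<open>x /\<^sub>R norm x\<close> only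
  tangentially: the derivative of normalization is the projection orthogonal to
  \<open>sgn x\<close>, divided by \<open>norm x\<close>. At the origin both terms of the formula
  are 0, in agreement with the function vanishing nearby.\<close>

lemma has_derivative_radial_extension:
  fixes \<phi> :: "'a::euclidean_space \<Rightarrow> real"
  assumes "\<And>x. (\<phi> has_derivative (\<lambda>w. D x \<bullet> w)) (at x)"
  shows "((\<lambda>x. bump (norm x) * \<phi> (x /\<^sub>R norm x)) has_derivative
    (\<lambda>w. bump' (norm x) * (sgn x \<bullet> w) * \<phi> (sgn x) +
      bump (norm x) / norm x * (D (sgn x) \<bullet> w - (sgn x \<bullet> w) * (D (sgn x) \<bullet> sgn x)))) (at x)"
proof (cases "x = 0")
  case True
  have "((\<lambda>x. 0) has_derivative (\<lambda>w::'a. 0::real)) (at x)" by simp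
  then have "((\<lambda>x. bump (norm x) * \<phi> (x /\<^sub>R norm x)) has_derivative (\<lambda>w::'a. 0::real)) (at x)"
    by (rule has_derivative_transform_within_open[OF _ open_ball[of 0 "1/4"]]) (auto simp: True bump_eq_0)
  then show ?thesis
    using True by (simp add: bump_eq_0)
next
  case False
  have 1: "((\<lambda>x. bump (norm x)) has_derivative (\<lambda>w. bump' (norm x) * (sgn x \<bullet> w))) (at x)"
    using has_derivative_compose[OF has_derivative_norm[OF False]
      bump_deriv[unfolded has_field_derivative_def]]
    by (simp add: inner_commute)
  have 2: "((\<lambda>x. x /\<^sub>R norm x) has_derivative (\<lambda>w. (w - (sgn x \<bullet> w) *\<^sub>R sgn x) /\<^sub>R norm x)) (at x)"
    using False
    by (auto intro!: derivative_eq_intros has_derivative_norm simp: sgn_div_norm algebra_simps power2_eq_square inner_commute divide_simps)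
  have 3: "((\<lambda>x. \<phi> (x /\<^sub>R norm x)) has_derivative (\<lambda>w. D (sgn x) \<bullet> ((w - (sgn x \<bullet> w) *\<^sub>R sgn x) /\<^sub>R norm x))) (at x)"
    using has_derivative_compose[OF 2 assms] by (simp add: sgn_div_norm)
  show ?thesis
    using has_derivative_mult[OF 1 3]
    by (rule has_derivative_eq_rhs) (auto simp: fun_eq_iff sgn_div_norm[symmetric] inner_diff_right divide_inverse algebra_simps)
qed

text \<open>The derivative of \<open>r ^ (n - 1) * bump r\<close> integrates to 0 over the unit
  interval, as the cutoff vanishes at both ends. The factor \<open>real n - 1\<close> produced here
  becomes the mean curvature in \<open>sphere_divergence\<close>, and positivity of the second
  integral permits cancelling it there.\<close>

lemma integral_bump_identity:
  assumes "2 \<le> n"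
  shows "(LINT r|radial_measure n. bump' r) = - (real n - 1) * (LINT r|radial_measure n. bump r / r)"
    and "0 < (LINT r|radial_measure n. bump r / r)"
proof -
  have n: "n - 1 = Suc (n - 2)" using assms by simp
  have pn: "r ^ (n - Suc 0) = r * r ^ (n - 2)" for r :: real
    using n by simp
  have m [measurable]: "bump \<in> borel_measurable borel" "bump' \<in> borel_measurable borel"
    using continuous_on_bump by (auto intro: borel_measurable_continuous_onI)
  have p: "r ^ (n - 1) * (bump r / r) = r ^ (n - 2) * bump r" for r
    by (cases "r = 0") (auto simp: pn bump_eq_0)
  have c: "continuous_on {0..1} (\<lambda>r. r ^ (n - 2) * bump r)" "continuous_on {0..1} (\<lambda>r. r ^ (n - 1) * bump' r)"
    by (intro continuous_intros continuous_on_bump)+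
  have s: "set_integrable lborel {0..1} (\<lambda>r. r ^ (n - 2) * bump r)"
    "set_integrable lborel {0..1} (\<lambda>r. r ^ (n - 1) * bump' r)"
    unfolding set_integrable_def by (intro borel_integrable_compact c compact_Icc)+
  have i1: "(LINT r|radial_measure n. bump r / r) = integral {0..1} (\<lambda>r. r ^ (n - 2) * bump r)"
    using s by (simp only: integral_radial_measure borel_measurable_divide m measurable_ident_sets[OF refl] p set_borel_integral_eq_integral(2))
  have i2: "(LINT r|radial_measure n. bump' r) = integral {0..1} (\<lambda>r. r ^ (n - 1) * bump' r)"
    using s by (simp only: integral_radial_measure m set_borel_integral_eq_integral(2))
  have "((\<lambda>r. r ^ (n - 1) * bump' r + (real n - 1) * (r ^ (n - 2) * bump r)) has_integral
      1 ^ (n - 1) * bump 1 - 0 ^ (n - 1) * bump 0) {0..1}"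
  proof (rule fundamental_theorem_of_calculus)
    fix r :: real
    have "((\<lambda>r. r ^ (n - 1) * bump r) has_real_derivative r ^ (n - 1) * bump' r + (real n - 1) * (r ^ (n - 2) * bump r)) (at r)"
      using assms by (auto intro!: derivative_eq_intros bump_deriv simp: of_nat_diff numeral_2_eq_2)
    then show "((\<lambda>r. r ^ (n - 1) * bump r) has_vector_derivative r ^ (n - 1) * bump' r + (real n - 1) * (r ^ (n - 2) * bump r)) (at r within {0..1})"
      using has_real_derivative_iff_has_vector_derivative has_vector_derivative_at_within by blast
  qed simp
  then have "integral {0..1} (\<lambda>r. r ^ (n - 1) * bump' r + (real n - 1) * (r ^ (n - 2) * bump r)) = 0"
    by (simp add: integral_unique bump_eq_0)
  then have "(LINT r|radial_measure n. bump' r) + (real n - 1) * (LINT r|radial_measure n. bump r / r) = 0"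
    using s by (simp add: i1 i2 integral_add set_borel_integral_eq_integral(1))
  then show "(LINT r|radial_measure n. bump' r) = - (real n - 1) * (LINT r|radial_measure n. bump r / r)"
    by (simp add: algebra_simps)
  have "integral {0..1} (\<lambda>r. r ^ (n - 2) * bump r) \<noteq> 0"
  proof
    assume "integral {0..1} (\<lambda>r. r ^ (n - 2) * bump r) = 0"
    then have "\<forall>r\<in>{0..1}. r ^ (n - 2) * bump r = 0"
      using integral_eq_0_iff[OF c(1)] by (simp add: bump_def)
    then have "(1/2) ^ (n - 2) * bump (1/2) = (0::real)"
      by (rule bspec) simp
    then show False using bump_pos[of "1/2"] by simp
  qed
  moreover have "0 \<le> integral {0..1} (\<lambda>r. r ^ (n - 2) * bump r)"
    by (intro integral_nonneg set_borel_integral_eq_integral(1) s) (auto simp: bump_def)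
  ultimately show "0 < (LINT r|radial_measure n. bump r / r)"
    by (simp add: i1)
qed

text \<open>The cutoff is 0 up to radius 1/4, so dividing by the radius costs at most a factor
  4.\<close>

lemma bump_div_bound: "\<bar>bump r / r\<bar> \<le> 4"
proof (cases "r \<le> 1/4")
  case False
  then show ?thesis using bump_bounds(1)[of r] by (simp add: abs_divide divide_le_eq)
qed (simp add: bump_eq_0)

text \<open>The left integrand is the derivative of \<open>\<phi>\<close> along the tangential part
  of \<open>v\<close>, and \<open>CARD('n) - 1\<close> is the mean curvature of the sphere. The
  v-derivative of the radial extension has integral 0 over the space. In polar coordinates this
  integral is a combination of the two spherical integrals, with the integrals of
  \<open>bump'\<close> and \<open>bump r / r\<close> as coefficients, whose ratio is known.\<close>

lemma sphere_divergence:
  fixes \<phi> :: "real^'n \<Rightarrow> real"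
  assumes n: "2 \<le> CARD('n)"
    and der: "\<And>x. (\<phi> has_derivative (\<lambda>w. D x \<bullet> w)) (at x)"
    and D: "continuous_on UNIV D"
  shows "(LINT e|sphere_measure. D e \<bullet> v - (e \<bullet> v) * (D e \<bullet> e)) =
    (real CARD('n) - 1) * (LINT e|sphere_measure. (e \<bullet> v) * \<phi> e)"
proof -
  have c\<phi>: "continuous_on UNIV \<phi>"
    using has_derivative_continuous[OF der] by (simp add: continuous_on_eq_continuous_at)
  define g where "g e = D e \<bullet> v - (e \<bullet> v) * (D e \<bullet> e)" for e
  define h where "h e = (e \<bullet> v) * \<phi> e" for e
  have cg: "continuous_on S g" and ch: "continuous_on S h" for S
    unfolding g_def[abs_def] h_def[abs_def]
    by (intro continuous_intros continuous_on_subset[OF D] continuous_on_subset[OF c\<phi>] subset_UNIV)+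
  \<comment> \<open>Since \<open>sgn 0\<close> is \<open>0\<close>, the bounds on \<open>g\<close>
    and \<open>h\<close> are taken over the closed ball instead of the sphere; they then hold at
    \<open>sgn x\<close> for every \<open>x\<close>.\<close>
  have sph: "sgn x \<in> cball 0 1" for x :: "real^'n" by (simp add: norm_sgn)
  obtain G where G: "\<And>x. x \<in> cball 0 1 \<Longrightarrow> \<bar>g x\<bar> \<le> G"
    using compact_imp_bounded[OF compact_continuous_image[OF cg[of "cball 0 1"] compact_cball]]
    unfolding bounded_iff real_norm_def by blast
  obtain H where H: "\<And>x. x \<in> cball 0 1 \<Longrightarrow> \<bar>h x\<bar> \<le> H"
    using compact_imp_bounded[OF compact_continuous_image[OF ch[of "cball 0 1"] compact_cball]]
    unfolding bounded_iff real_norm_def by blast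
  define F where "F x = bump' (norm x) * h (sgn x) + bump (norm x) / norm x * g (sgn x)" for x
  have bG: "\<bar>F x\<bar> \<le> 2 * H + 4 * G" for x
  proof -
    have G0: "0 \<le> G" and H0: "0 \<le> H"
      using G[of 0] H[of 0] by (auto intro: order_trans[OF abs_ge_zero])
    have "\<bar>bump' (norm x) * h (sgn x)\<bar> \<le> 2 * H"
      unfolding abs_mult by (intro mult_mono bump_bounds H sph) (use H0 in auto)
    moreover have "\<bar>bump (norm x) / norm x * g (sgn x)\<bar> \<le> 4 * G"
      unfolding abs_mult[of "_ / _"] by (intro mult_mono G sph bump_div_bound) auto
    ultimately show ?thesis unfolding F_def by linarith
  qed
  have deriv: "((\<lambda>x. bump (norm x) * \<phi> (x /\<^sub>R norm x)) has_derivative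
    (\<lambda>w. bump' (norm x) * (sgn x \<bullet> w) * \<phi> (sgn x) +
      bump (norm x) / norm x * (D (sgn x) \<bullet> w - (sgn x \<bullet> w) * (D (sgn x) \<bullet> sgn x)))) (at x)" for x
    by (rule has_derivative_radial_extension[OF der])
  have F: "F x = bump' (norm x) * (sgn x \<bullet> v) * \<phi> (sgn x) +
      bump (norm x) / norm x * (D (sgn x) \<bullet> v - (sgn x \<bullet> v) * (D (sgn x) \<bullet> sgn x))" for x
    by (simp add: F_def g_def h_def)
  have "integrable lborel F" "(LINT x|lborel. F x) = 0"
    using integral_directional_derivative_eq_0[OF deriv, of "3/4" v "2 * H + 4 * G"] bG
    unfolding F[symmetric] by (simp_all add: bump_eq_0)
  \<comment> \<open>The cutoff vanishes from radius 3/4 on, so integrating over the unit ball loses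
    nothing.\<close>
  moreover have "F = (\<lambda>x. indicator (ball 0 1) x *\<^sub>R F x)"
    by (auto simp: fun_eq_iff indicator_def F_def bump_eq_0)
  ultimately have "set_integrable lborel (ball 0 1) F" "(LINT x:ball 0 1|lborel. F x) = 0"
    unfolding set_integrable_def set_lebesgue_integral_def by simp_all
  moreover have "F \<in> borel_measurable borel"
    using \<open>integrable lborel F\<close> by (auto dest: borel_measurable_integrable)
  ultimately have "0 = (LINT r|radial_measure CARD('n). LINT e|sphere_measure. F (r *\<^sub>R e))"
    using integral_polar_radial_outer[of F] by simp
  also have "\<dots> = (LINT r|radial_measure CARD('n). bump' r * (LINT e|sphere_measure. h e) + bump r / r * (LINT e|sphere_measure. g e))"
  proof (rule integral_cong_AE)
    show "AE r in radial_measure CARD('n). (LINT e|sphere_measure. F (r *\<^sub>R e)) =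
        bump' r * (LINT e|sphere_measure. h e) + bump r / r * (LINT e|sphere_measure. g e)"
      using AE_radial_measure
    proof eventually_elim
      fix r :: real assume r: "0 < r \<and> r < 1"
      have "(LINT e|sphere_measure. F (r *\<^sub>R e)) = (LINT e|sphere_measure. bump' r * h e + bump r / r * g e)"
        using r by (intro Bochner_Integration.integral_cong refl) (simp add: F_def sgn_div_norm)
      then show "(LINT e|sphere_measure. F (r *\<^sub>R e)) =
          bump' r * (LINT e|sphere_measure. h e) + bump r / r * (LINT e|sphere_measure. g e)"
        by (simp add: integrable_sphere_measure cg ch)
    qed
    show "(\<lambda>r. LINT e|sphere_measure. F (r *\<^sub>R e)) \<in> borel_measurable (radial_measure CARD('n))"
      using measurable_scaleR_polar[OF \<open>F \<in> borel_measurable borel\<close>]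
      by (intro sphere_measure.borel_measurable_lebesgue_integral) 
    show "(\<lambda>r. bump' r * (LINT e|sphere_measure. h e) + bump r / r * (LINT e|sphere_measure. g e)) \<in> borel_measurable (radial_measure CARD('n))"
      using continuous_on_bump[THEN borel_measurable_continuous_onI]
      by (simp add: measurable_cong_sets[OF sets_radial_measure refl])
  qed
  also have "\<dots> = (LINT r|radial_measure CARD('n). bump' r) * (LINT e|sphere_measure. h e) +
      (LINT r|radial_measure CARD('n). bump r / r) * (LINT e|sphere_measure. g e)"
  proof -
    interpret R: finite_measure "radial_measure CARD('n)" by (rule finite_measure_radial_measure) simp
    have "integrable (radial_measure CARD('n)) bump'" "integrable (radial_measure CARD('n)) (\<lambda>r. bump r / r)"
      using continuous_on_bump[THEN borel_measurable_continuous_onI]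
      by (auto intro!: R.integrable_const_bound[of _ 4] AE_I2 order_trans[OF bump_bounds(2)] bump_div_bound[unfolded abs_divide]
        simp: measurable_cong_sets[OF sets_radial_measure refl])
    then show ?thesis
      by (simp only: Bochner_Integration.integral_add integrable_mult_left integral_mult_left_zero)
  qed
  finally have "(LINT r|radial_measure CARD('n). bump r / r) *
      ((LINT e|sphere_measure. g e) - (real CARD('n) - 1) * (LINT e|sphere_measure. h e)) = 0"
    unfolding integral_bump_identity(1)[OF n] by (simp add: algebra_simps)
  then show ?thesis
    using integral_bump_identity(2)[OF n] by (simp add: g_def[symmetric] h_def[symmetric])
qed

section \<open>Integration by parts against a power weight\<close>

lemma sgn_borel_measurable: "(sgn :: real^'n \<Rightarrow> real^'n) \<in> borel_measurable borel"
  unfolding sgn_div_norm[abs_def] by simp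

text \<open>In polar coordinates the majorant becomes r^(d-1-a) on the unit interval, which is
  integrable for \<open>a\<close> below the dimension. As \<open>0 powr _\<close> is
  \<open>0\<close>, the bound also forces \<open>G 0 = 0\<close>; the integrands met below satisfy
  this by the same convention.\<close>

lemma set_integrable_norm_powr_bound:
  fixes G :: "real^'n \<Rightarrow> 'b::{banach, second_countable_topology}"
  assumes G [measurable]: "G \<in> borel_measurable borel" and a: "a < real CARD('n)"
    and bound: "\<And>x. x \<in> ball 0 1 \<Longrightarrow> norm (G x) \<le> C * norm x powr (- a)"
  shows "set_integrable lborel (ball 0 1) G"
proof -
  have "(\<integral>\<^sup>+x\<in>ball 0 1. ennreal (norm x powr (- a)) \<partial>(lborel :: (real^'n) measure)) =
      (\<integral>\<^sup>+r. \<integral>\<^sup>+e. ennreal (norm (r *\<^sub>R e) powr (- a)) \<partial>(sphere_measure :: (real^'n) measure) \<partial>radial_measure CARD('n))"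
    by (rule nn_integral_polar) simp
  also have "\<dots> = (\<integral>\<^sup>+r. ennreal (r powr (- a)) * emeasure sphere_measure (sphere (0::real^'n) 1) \<partial>radial_measure CARD('n))"
  proof (rule nn_integral_cong_AE, use AE_radial_measure in eventually_elim)
    fix r :: real assume "0 < r \<and> r < 1"
    then have "(\<integral>\<^sup>+e. ennreal (norm (r *\<^sub>R e) powr (- a)) \<partial>(sphere_measure :: (real^'n) measure)) =
        (\<integral>\<^sup>+e. ennreal (r powr (- a)) \<partial>(sphere_measure :: (real^'n) measure))"
      by (intro nn_integral_cong) simp
    then show "(\<integral>\<^sup>+e. ennreal (norm (r *\<^sub>R e) powr (- a)) \<partial>(sphere_measure :: (real^'n) measure)) =
        ennreal (r powr (- a)) * emeasure sphere_measure (sphere (0::real^'n) 1)"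
      by simp
  qed
  also have "\<dots> = ennreal (1 / (real CARD('n) - a)) * emeasure sphere_measure (sphere (0::real^'n) 1)"
    using nn_integral_powr_radial_measure[OF zero_less_card_finite a]
    by (subst nn_integral_multc) (simp_all add: measurable_cong_sets[OF sets_radial_measure refl])
  also have "\<dots> < \<infinity>"
    using sphere_measure.emeasure_finite[of "sphere (0::real^'n) 1"] by (simp add: less_top[symmetric] ennreal_mult_eq_top_iff)
  finally have fin: "(\<integral>\<^sup>+x\<in>ball 0 1. ennreal (norm x powr (- a)) \<partial>(lborel :: (real^'n) measure)) < \<infinity>" .
  have i: "integrable lborel (\<lambda>x::real^'n. indicator (ball 0 1) x * norm x powr (- a))"
  proof (rule integrableI_bounded)
    have "(\<integral>\<^sup>+x. ennreal (norm (indicator (ball 0 1) x * norm x powr (- a))) \<partial>(lborel :: (real^'n) measure)) =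
        (\<integral>\<^sup>+x\<in>ball 0 1. ennreal (norm x powr (- a)) \<partial>(lborel :: (real^'n) measure))"
      by (intro nn_integral_cong) (simp add: indicator_def)
    then show "(\<integral>\<^sup>+x. ennreal (norm (indicator (ball 0 1) x * norm x powr (- a))) \<partial>(lborel :: (real^'n) measure)) < \<infinity>"
      using fin by simp
  qed (intro borel_measurable_times borel_measurable_indicator, simp_all)
  have "integrable lborel (\<lambda>x::real^'n. C * (indicator (ball 0 1) x * norm x powr (- a)))"
    by (rule integrable_mult_right) (rule i)
  then show ?thesis
    unfolding set_integrable_def
  proof (rule Bochner_Integration.integrable_bound)
    show "(\<lambda>x. indicator (ball 0 1) x *\<^sub>R G x) \<in> borel_measurable lborel"
      using G by (intro borel_measurable_scaleR borel_measurable_indicator) simp_all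
    show "AE x in lborel. norm (indicator (ball 0 1) x *\<^sub>R G x) \<le> norm (C * (indicator (ball 0 1) x * norm x powr (- a)))"
    proof (rule AE_I2)
      fix x :: "real^'n"
      show "norm (indicator (ball 0 1) x *\<^sub>R G x) \<le> norm (C * (indicator (ball 0 1) x * norm x powr (- a)))"
      proof (cases "x \<in> ball 0 1")
        case True
        then show ?thesis using bound[OF True] by (simp add: order_trans[OF _ abs_ge_self])
      qed simp
    qed
  qed
qed

lemma integrable_radial_measure_powr_bound:
  fixes G :: "real \<Rightarrow> real"
  assumes [measurable]: "G \<in> borel_measurable borel" and n: "0 < n" "a < real n"
    and bound: "\<And>r. 0 < r \<Longrightarrow> r < 1 \<Longrightarrow> \<bar>G r\<bar> \<le> C * r powr (- a)"
  shows "integrable (radial_measure n) G"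
proof -
  have "integrable (radial_measure n) (\<lambda>r. r powr (- a))"
    by (rule integrableI_bounded)
      (simp_all add: measurable_cong_sets[OF sets_radial_measure refl] nn_integral_powr_radial_measure[OF n])
  then have "integrable (radial_measure n) (\<lambda>r. C * r powr (- a))"
    by (rule integrable_mult_right)
  then show ?thesis
  proof (rule Bochner_Integration.integrable_bound)
    show "AE r in radial_measure n. norm (G r) \<le> norm (C * r powr (- a))"
      using AE_radial_measure by eventually_elim (auto intro: order_trans[OF bound abs_ge_self])
  qed (simp add: measurable_cong_sets[OF sets_radial_measure refl])
qed

lemma continuous_bounded_cball:
  fixes D :: "'a::euclidean_space \<Rightarrow> 'b::real_normed_vector"
  assumes "continuous_on UNIV D"
  obtains A where "0 \<le> A" "\<And>x. norm x \<le> 1 \<Longrightarrow> norm (D x) \<le> A"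
proof -
  have "bounded (D ` cball 0 1)"
    by (intro compact_imp_bounded compact_continuous_image continuous_on_subset[OF assms]) auto
  then obtain A where A: "\<forall>x\<in>D ` cball 0 1. norm x \<le> A"
    unfolding bounded_iff by blast
  show ?thesis
  proof (rule that)
    show "norm (D x) \<le> A" if "norm x \<le> 1" for x
      using A that by (auto simp: image_iff)
    from this[of 0] show "0 \<le> A" by (auto intro: order_trans[OF norm_ge_zero])
  qed
qed

lemma abs_inner_sgn_le: "\<bar>x \<bullet> sgn y\<bar> \<le> norm x" "\<bar>sgn y \<bullet> x\<bar> \<le> norm x"
proof -
  have "norm (sgn y) \<le> 1" by (simp add: norm_sgn)
  then show "\<bar>x \<bullet> sgn y\<bar> \<le> norm x"
    using Cauchy_Schwarz_ineq2[of x "sgn y"] mult_left_le[of "norm (sgn y)" "norm x"] by simp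
  then show "\<bar>sgn y \<bullet> x\<bar> \<le> norm x" by (simp add: inner_commute)
qed

text \<open>With T the radial field, \<open>F x\<close> is T(x) v paired with the gradient of
  \<open>\<phi>\<close>, so this is Gauss's formula for T v on the ball. It serves twice: for weak
  vanishing of the divergence, with \<open>\<phi>\<close> zero on the sphere, and for the normal
  trace. The origin adds no term because r^(d-1-m) tends to 0 there.\<close>

lemma ball_divergence:
  fixes \<phi> :: "real^'n \<Rightarrow> real" and v :: "real^'n"
  assumes n: "2 \<le> CARD('n)" and m: "m < real CARD('n) - 1"
    and der: "\<And>x. (\<phi> has_derivative (\<lambda>w. D x \<bullet> w)) (at x)"
    and D: "continuous_on UNIV D"
  defines "F \<equiv> \<lambda>x. norm x powr (- m) *
      (m * (sgn x \<bullet> v) * (D x \<bullet> sgn x) + (real CARD('n) - 1 - m) * (D x \<bullet> v))"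
  shows "set_integrable lborel (ball 0 1) F"
    and "(LINT x:ball 0 1|lborel. F x) = (real CARD('n) - 1) * (LINT e|sphere_measure. (e \<bullet> v) * \<phi> e)"
proof -
  define k where "k = real CARD('n) - 1 - m"
  have k: "0 < k" using m by (simp add: k_def)
  (* On the sphere of radius r, sphere_divergence exchanges F for G, and r^(d-1) G(r e) is the
     derivative of (d-1) (e . v) r^k phi(r e) in r. *)
  define G where "G x = norm x powr (- m) *
      ((real CARD('n) - 1) * (sgn x \<bullet> v) * (D x \<bullet> sgn x + k * \<phi> x / norm x))" for x
  have c\<phi>: "continuous_on UNIV \<phi>"
    using has_derivative_continuous[OF der] by (simp add: continuous_on_eq_continuous_at)
  have [measurable]: "sgn \<in> borel_measurable (borel :: (real^'n) measure)"
    "D \<in> borel_measurable borel" "\<phi> \<in> borel_measurable borel"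
    by (rule sgn_borel_measurable borel_measurable_continuous_onI[OF D] borel_measurable_continuous_onI[OF c\<phi>])+
  have Fm: "F \<in> borel_measurable borel" and Gm: "G \<in> borel_measurable borel"
    unfolding F_def G_def[abs_def] by measurable
  obtain A where A: "0 \<le> A" "\<And>x. norm x \<le> 1 \<Longrightarrow> norm (D x) \<le> A"
    by (rule continuous_bounded_cball[OF D]) (rule that)
  obtain B where B: "0 \<le> B" "\<And>x. norm x \<le> 1 \<Longrightarrow> norm (\<phi> x) \<le> B"
    by (rule continuous_bounded_cball[OF c\<phi>]) (rule that)
  have Fb: "norm (F x) \<le> ((\<bar>m\<bar> + k) * norm v * A) * norm x powr (- m)" if "x \<in> ball 0 1" for x
  proof -
    have "\<bar>(sgn x \<bullet> v) * (D x \<bullet> sgn x)\<bar> \<le> norm v * A"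
      unfolding abs_mult using A(2)[of x] that A(1)
      by (intro mult_mono abs_inner_sgn_le order_trans[OF abs_inner_sgn_le(1)]) auto
    then have "\<bar>m * ((sgn x \<bullet> v) * (D x \<bullet> sgn x))\<bar> \<le> \<bar>m\<bar> * (norm v * A)"
      unfolding abs_mult[of m] by (intro mult_left_mono) auto
    moreover have "\<bar>D x \<bullet> v\<bar> \<le> A * norm v"
      using A(2)[of x] that by (intro order_trans[OF Cauchy_Schwarz_ineq2] mult_right_mono) auto
    then have "\<bar>k * (D x \<bullet> v)\<bar> \<le> k * (A * norm v)"
      unfolding abs_mult using k by (simp add: mult_left_mono)
    ultimately have "\<bar>m * (sgn x \<bullet> v) * (D x \<bullet> sgn x) + k * (D x \<bullet> v)\<bar> \<le> (\<bar>m\<bar> + k) * norm v * A"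
      by (simp add: algebra_simps)
    then show ?thesis
      unfolding F_def k_def[symmetric] by (simp add: abs_mult mult.commute[of _ "norm x powr _"] mult_left_mono)
  qed
  show int_F: "set_integrable lborel (ball 0 1) F"
    by (rule set_integrable_norm_powr_bound[OF Fm _ Fb]) (use m in simp)
  define C where "C = (real CARD('n) - 1) * norm v * (A + k * B)"
  \<comment> \<open>Dividing \<open>\<phi>\<close> by the radius makes \<open>G\<close> one power
    more singular than \<open>F\<close>. Integrability now asks for \<open>m + 1\<close> below the
    dimension, which is the hypothesis on \<open>m\<close>.\<close>
  have Gb: "norm (G x) \<le> C * norm x powr (- (m + 1))" if x: "x \<in> ball 0 1" for x
  proof (cases "x = 0")
    case False
    have "\<bar>D x \<bullet> sgn x\<bar> \<le> A / norm x"
      using order_trans[OF abs_inner_sgn_le(1) A(2)[of x]] x False A(1)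
      by (simp add: le_divide_eq) (meson mult_left_le order_trans less_imp_le abs_ge_zero)
    moreover have "\<bar>k * \<phi> x / norm x\<bar> \<le> k * B / norm x"
      using B(2)[of x] x k by (simp add: abs_mult divide_right_mono)
    ultimately have "\<bar>D x \<bullet> sgn x + k * \<phi> x / norm x\<bar> \<le> (A + k * B) / norm x"
      unfolding add_divide_distrib by linarith
    moreover have "\<bar>(real CARD('n) - 1) * (sgn x \<bullet> v)\<bar> \<le> (real CARD('n) - 1) * norm v"
      unfolding abs_mult using n by (simp add: mult_left_mono abs_inner_sgn_le)
    ultimately have "\<bar>(real CARD('n) - 1) * (sgn x \<bullet> v) * (D x \<bullet> sgn x + k * \<phi> x / norm x)\<bar> \<le> C / norm x"
      unfolding C_def abs_mult[of "(real CARD('n) - 1) * (sgn x \<bullet> v)"] times_divide_eq_right[symmetric]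
      using n by (intro mult_mono) auto
    then have "norm (G x) \<le> norm x powr (- m) * (C / norm x)"
      unfolding G_def real_norm_def abs_mult[of "norm x powr _"] by (intro mult_mono) auto
    also have "\<dots> = C * norm x powr (- (m + 1))"
      using False by (simp add: powr_diff)
    finally show ?thesis .
  qed (simp add: G_def)
  have int_G: "set_integrable lborel (ball 0 1) G"
    by (rule set_integrable_norm_powr_bound[OF Gm _ Gb]) (use m in simp)
  have "(LINT x:ball 0 1|lborel. F x) = (LINT r|radial_measure CARD('n). LINT e|sphere_measure. F (r *\<^sub>R e))"
    by (rule integral_polar_radial_outer[OF Fm int_F])
  also have "\<dots> = (LINT r|radial_measure CARD('n). LINT e|sphere_measure. G (r *\<^sub>R e))"
  proof (rule integral_cong_AE)
    show "(\<lambda>r. LINT e|sphere_measure. F (r *\<^sub>R e)) \<in> borel_measurable (radial_measure CARD('n))"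
      using measurable_scaleR_polar[OF Fm] by (rule sphere_measure.borel_measurable_lebesgue_integral)
    show "(\<lambda>r. LINT e|sphere_measure. G (r *\<^sub>R e)) \<in> borel_measurable (radial_measure CARD('n))"
      using measurable_scaleR_polar[OF Gm] by (rule sphere_measure.borel_measurable_lebesgue_integral)
    show "AE r in radial_measure CARD('n). (LINT e|sphere_measure. F (r *\<^sub>R e)) = (LINT e|sphere_measure. G (r *\<^sub>R e))"
      using AE_radial_measure
    proof eventually_elim
      fix r :: real assume r: "0 < r \<and> r < 1"
      have cr: "continuous_on S (\<lambda>x. D (r *\<^sub>R x))" "continuous_on S (\<lambda>x. \<phi> (r *\<^sub>R x))" for S
        by (intro continuous_on_compose2[OF D] continuous_on_compose2[OF c\<phi>] continuous_intros; simp)+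
      have "((\<lambda>x. \<phi> (r *\<^sub>R x)) has_derivative (\<lambda>w. (r *\<^sub>R D (r *\<^sub>R x)) \<bullet> w)) (at x)" for x
      proof -
        have "((\<lambda>x. r *\<^sub>R x) has_derivative (\<lambda>w. r *\<^sub>R w)) (at x)"
          by (auto intro!: derivative_eq_intros)
        from has_derivative_compose[OF this der] show ?thesis by simp
      qed
      from sphere_divergence[OF n this, of v]
      have S: "(LINT e|sphere_measure. r * (D (r *\<^sub>R e) \<bullet> v) - (e \<bullet> v) * (r * (D (r *\<^sub>R e) \<bullet> e))) =
          (real CARD('n) - 1) * (LINT e|sphere_measure. (e \<bullet> v) * \<phi> (r *\<^sub>R e))"
        using cr by (simp add: continuous_intros)
      \<comment> \<open>This is the multiple of the spherical identity \<open>S\<close> that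
        separates \<open>F\<close> from \<open>G\<close>; the division by \<open>r\<close> undoes
        the factor that the chain rule gives to the gradient of e -> phi(r e).\<close>
      define a where "a = r powr (- m) * k / r"
      have eq: "F (r *\<^sub>R e) = G (r *\<^sub>R e) + a * ((r * (D (r *\<^sub>R e) \<bullet> v) - (e \<bullet> v) * (r * (D (r *\<^sub>R e) \<bullet> e))) -
          (real CARD('n) - 1) * ((e \<bullet> v) * \<phi> (r *\<^sub>R e)))" if "norm e = 1" for e
      proof -
        have s: "sgn (r *\<^sub>R e) = e" using r that by (simp add: sgn_div_norm)
        have mk: "m = real CARD('n) - 1 - k" by (simp add: k_def)
        show ?thesis
          using r that unfolding F_def G_def s k_def[symmetric] a_def
          by (simp add: field_simps) (simp add: mk algebra_simps)
      qed
      have i: "integrable sphere_measure (\<lambda>e. G (r *\<^sub>R e))"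
      proof -
        have "integrable sphere_measure (\<lambda>e. r powr (- m) * ((real CARD('n) - 1) * (e \<bullet> v) * (D (r *\<^sub>R e) \<bullet> e + k * \<phi> (r *\<^sub>R e) / r)))"
          by (intro integrable_sphere_measure continuous_intros cr) (use r in auto)
        then show ?thesis
          by (rule Bochner_Integration.integrable_cong[THEN iffD1, OF refl, rotated])
            (use r in \<open>simp add: G_def sgn_div_norm\<close>)
      qed
      have j: "integrable sphere_measure (\<lambda>e. r * (D (r *\<^sub>R e) \<bullet> v) - (e \<bullet> v) * (r * (D (r *\<^sub>R e) \<bullet> e)))"
        "integrable sphere_measure (\<lambda>e. (e \<bullet> v) * \<phi> (r *\<^sub>R e))"
        by (intro integrable_sphere_measure continuous_intros cr)+
      have "(LINT e|sphere_measure. F (r *\<^sub>R e)) =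
          (LINT e|sphere_measure. G (r *\<^sub>R e) + a * ((r * (D (r *\<^sub>R e) \<bullet> v) - (e \<bullet> v) * (r * (D (r *\<^sub>R e) \<bullet> e))) -
          (real CARD('n) - 1) * ((e \<bullet> v) * \<phi> (r *\<^sub>R e))))"
        by (rule Bochner_Integration.integral_cong[OF refl]) (rule eq, simp)
      also have "\<dots> = (LINT e|sphere_measure. G (r *\<^sub>R e)) +
          a * ((LINT e|sphere_measure. r * (D (r *\<^sub>R e) \<bullet> v) - (e \<bullet> v) * (r * (D (r *\<^sub>R e) \<bullet> e))) -
          (real CARD('n) - 1) * (LINT e|sphere_measure. (e \<bullet> v) * \<phi> (r *\<^sub>R e)))"
        using i j by (simp only: Bochner_Integration.integral_add Bochner_Integration.integral_diff
          integral_mult_right_zero integrable_mult_right Bochner_Integration.integrable_diff)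
      finally show "(LINT e|sphere_measure. F (r *\<^sub>R e)) = (LINT e|sphere_measure. G (r *\<^sub>R e))"
        by (simp only: S diff_self mult_zero_right add_0_right)
    qed
  qed
  also have "\<dots> = (LINT e|sphere_measure. LINT r|radial_measure CARD('n). G (r *\<^sub>R e))"
    using integral_polar_radial_outer[OF Gm int_G] integral_polar_sphere_outer[OF Gm int_G] by simp
  also have "\<dots> = (LINT e|sphere_measure. (real CARD('n) - 1) * ((e \<bullet> v) * \<phi> e))"
  proof (rule Bochner_Integration.integral_cong[OF refl])
    fix e :: "real^'n" assume "e \<in> space sphere_measure"
    then have e: "norm e = 1" by simp
    have Gem: "(\<lambda>r. G (r *\<^sub>R e)) \<in> borel_measurable borel"
      by (rule measurable_compose[OF _ Gm]) simp
    have "integrable (radial_measure CARD('n)) (\<lambda>r. G (r *\<^sub>R e))"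
    proof (rule integrable_radial_measure_powr_bound[OF Gem])
      fix r :: real assume "0 < r" "r < 1"
      then show "\<bar>G (r *\<^sub>R e)\<bar> \<le> C * r powr (- (m + 1))"
        using Gb[of "r *\<^sub>R e"] e by simp
    qed (use m in auto)
    then have i: "set_integrable lborel {0..1} (\<lambda>r. r ^ (CARD('n) - 1) * G (r *\<^sub>R e))"
      by (simp only: integrable_radial_measure_iff[OF Gem])
    \<comment> \<open>Positivity of \<open>k\<close> makes \<open>?P\<close> continuous at 0 with
      value 0, which is all that is asked at that end; differentiability may fail there when
      \<open>k < 1\<close>.\<close>
    let ?P = "\<lambda>r. (real CARD('n) - 1) * (e \<bullet> v) * (r powr k * \<phi> (r *\<^sub>R e))"
    have "((\<lambda>r. r ^ (CARD('n) - 1) * G (r *\<^sub>R e)) has_integral ?P 1 - ?P 0) {0..1}"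
    proof (rule fundamental_theorem_of_calculus_interior)
      show "continuous_on {0..1} ?P"
        using k by (intro continuous_intros continuous_on_powr' continuous_on_compose2[OF c\<phi>]) auto
      fix r :: real assume "r \<in> {0<..<1}"
      then have r: "0 < r" "r < 1" by auto
      have "((\<lambda>t. \<phi> (0 + t *\<^sub>R e)) has_real_derivative D (0 + r *\<^sub>R e) \<bullet> e) (at r)"
        by (rule has_real_derivative_along_line[OF der])
      then have d: "((\<lambda>t. \<phi> (t *\<^sub>R e)) has_real_derivative D (r *\<^sub>R e) \<bullet> e) (at r)"
        by simp
      have "r ^ (CARD('n) - 1) * r powr (- m) = r powr k"
        using r n by (simp add: k_def powr_realpow[symmetric] powr_add[symmetric] of_nat_diff)
      moreover have "G (r *\<^sub>R e) = r powr (- m) *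
          ((real CARD('n) - 1) * (e \<bullet> v) * (D (r *\<^sub>R e) \<bullet> e + k * \<phi> (r *\<^sub>R e) / r))"
        using r e by (simp add: G_def sgn_div_norm)
      ultimately have *: "r ^ (CARD('n) - 1) * G (r *\<^sub>R e) = r powr k *
          ((real CARD('n) - 1) * (e \<bullet> v) * (D (r *\<^sub>R e) \<bullet> e + k * \<phi> (r *\<^sub>R e) / r))"
        by (simp only: mult.assoc[symmetric])
      have "(?P has_real_derivative r ^ (CARD('n) - 1) * G (r *\<^sub>R e)) (at r)"
        unfolding * using r
        by (auto intro!: derivative_eq_intros d simp: powr_diff field_simps)
      then show "(?P has_vector_derivative r ^ (CARD('n) - 1) * G (r *\<^sub>R e)) (at r)"
        by (simp add: has_real_derivative_iff_has_vector_derivative)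
    qed simp
    then have "(LINT r|radial_measure CARD('n). G (r *\<^sub>R e)) = ?P 1 - ?P 0"
      by (simp only: integral_radial_measure[OF Gem] set_borel_integral_eq_integral(2)[OF i] integral_unique)
    then show "(LINT r|radial_measure CARD('n). G (r *\<^sub>R e)) = (real CARD('n) - 1) * ((e \<bullet> v) * \<phi> e)"
      by simp
  qed
  finally show "(LINT x:ball 0 1|lborel. F x) = (real CARD('n) - 1) * (LINT e|sphere_measure. (e \<bullet> v) * \<phi> e)"
    by simp
qed

section \<open>The radial tensor fields\<close>

lemma tensor_mult_vec: "tensor v w *v x = (w \<bullet> x) *\<^sub>R v"
  by (simp add: vec_eq_iff matrix_vector_mult_def tensor_def inner_vec_def sum_distrib_left mult_ac)

lemma transpose_tensor: "transpose (tensor v v) = tensor v v"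
  by (simp add: vec_eq_iff transpose_def tensor_def mult.commute)

lemma tensor_scaleR: "tensor (t *\<^sub>R v) (t *\<^sub>R v) = t\<^sup>2 *\<^sub>R tensor v v"
  by (simp add: vec_eq_iff tensor_def power2_eq_square mult_ac)

lemma continuous_on_tensor: "continuous_on S (\<lambda>v. tensor v v)"
  unfolding tensor_def by (intro continuous_intros)

lemma scaleR_Sym_psd: "A \<in> Sym_psd \<Longrightarrow> 0 \<le> t \<Longrightarrow> t *\<^sub>R A \<in> Sym_psd"
  by (auto simp: Sym_psd_def transpose_scalar scaleR_matrix_vector_assoc[symmetric])

lemma tensor_Sym_psd: "tensor v v \<in> Sym_psd"
  by (simp add: Sym_psd_def transpose_tensor tensor_mult_vec inner_commute)

text \<open>Closedness makes the cone a Borel set, so that a function known to be continuous only on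
  it has a Borel extension by zero.\<close>

lemma closed_Sym_psd: "closed (Sym_psd :: (real^'n^'n) set)"
proof -
  have sym: "closed {A :: real^'n^'n. A $ j $ i = A $ i $ j}" for i j
    by (intro closed_Collect_eq continuous_intros)
  have nonneg: "closed {A :: real^'n^'n. 0 \<le> x \<bullet> (A *v x)}" for x
    unfolding matrix_vector_mult_def inner_vec_def by (intro closed_Collect_le continuous_intros)
  have "Sym_psd = (\<Inter>i j. {A :: real^'n^'n. A $ j $ i = A $ i $ j}) \<inter> (\<Inter>x. {A. 0 \<le> x \<bullet> (A *v x)})"
    by (auto simp: Sym_psd_def transpose_def vec_eq_iff)
  also have "closed \<dots>"
    by (intro closed_Int closed_INT ballI sym nonneg)
  finally show ?thesis .
qed

text \<open>For a unit vector \<open>e\<close> the eigenvalues are \<open>CARD('n) - 1\<close> along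
  \<open>e\<close> and \<open>CARD('n) - 1 - m\<close> on its orthogonal complement.\<close>

definition profile :: "real \<Rightarrow> real^'n \<Rightarrow> real^'n^'n" where
  "profile m e = m *\<^sub>R tensor e e + (real CARD('n) - 1 - m) *\<^sub>R mat 1"

text \<open>At the origin the value is 0 for every \<open>m\<close>, even for
  \<open>m \<le> 0\<close>, because \<open>0 powr _\<close> is \<open>0\<close>; it thus lies in the
  cone as well.\<close>

definition radial_field :: "real \<Rightarrow> real^'n \<Rightarrow> real^'n^'n" where
  "radial_field m x = norm x powr (- m) *\<^sub>R profile m (sgn x)"

lemma continuous_on_profile: "continuous_on S (profile m)"
  unfolding profile_def[abs_def] by (intro continuous_intros continuous_on_tensor)

lemma profile_Sym_psd:
  fixes e :: "real^'n"
  assumes "m < real CARD('n) - 1" "norm e = 1"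
  shows "profile m e \<in> Sym_psd"
proof -
  have "0 \<le> x \<bullet> (profile m e *v x)" for x
  proof -
    have eq: "x \<bullet> (profile m e *v x) = m * (e \<bullet> x)\<^sup>2 + (real CARD('n) - 1 - m) * (x \<bullet> x)"
      by (simp add: profile_def matrix_vector_mult_add_rdistrib scaleR_matrix_vector_assoc[symmetric]
        tensor_mult_vec inner_add_right inner_commute power2_eq_square)
    have "(e \<bullet> x)\<^sup>2 \<le> x \<bullet> x"
      using Cauchy_Schwarz_ineq[of e x] assms(2) by (simp add: power2_norm_eq_inner[symmetric])
    \<comment> \<open>For \<open>m \<ge> 0\<close> both terms are nonnegative. For
      \<open>m < 0\<close> Cauchy-Schwarz replaces \<open>(e \<bullet> x)\<^sup>2\<close> by
      \<open>x \<bullet> x\<close> in the first term, and \<open>m\<close> cancels from the lower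
      bound.\<close>
    show ?thesis
    proof (cases "0 \<le> m")
      case True
      then show ?thesis unfolding eq using assms(1) by simp
    next
      case False
      then have "m * (x \<bullet> x) \<le> m * (e \<bullet> x)\<^sup>2"
        using \<open>(e \<bullet> x)\<^sup>2 \<le> x \<bullet> x\<close> by (intro mult_left_mono_neg) auto
      moreover have "0 \<le> (real CARD('n) - 1) * (x \<bullet> x)"
        by (intro mult_nonneg_nonneg) (auto simp: Suc_le_eq)
      ultimately show ?thesis unfolding eq by (simp add: left_diff_distrib)
    qed
  qed
  moreover have "transpose (profile m e) = profile m e"
    by (simp add: vec_eq_iff transpose_def profile_def tensor_def mat_def mult.commute)
  ultimately show ?thesis by (simp add: Sym_psd_def)
qed

lemma radial_field_Sym_psd:
  fixes x :: "real^'n"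
  assumes "m < real CARD('n) - 1"
  shows "radial_field m x \<in> Sym_psd"
proof (cases "x = 0")
  case True
  have "0 *\<^sub>R tensor x x \<in> Sym_psd" by (intro scaleR_Sym_psd tensor_Sym_psd) simp
  then show ?thesis using True by (simp add: radial_field_def)
next
  case False
  then show ?thesis
    unfolding radial_field_def by (intro scaleR_Sym_psd profile_Sym_psd assms) (simp_all add: norm_sgn)
qed

lemma radial_field_borel: "radial_field m \<in> borel_measurable (borel :: (real^'n) measure)"
  unfolding radial_field_def[abs_def]
  by (intro borel_measurable_scaleR measurable_compose[OF sgn_borel_measurable
    borel_measurable_continuous_onI[OF continuous_on_profile]]) simp

lemma radial_field_bound:
  obtains C where "0 \<le> C" "\<And>x :: real^'n. norm (radial_field m x) \<le> C * norm x powr (- m)"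
proof -
  obtain C where C: "0 \<le> C" "\<And>e :: real^'n. norm e \<le> 1 \<Longrightarrow> norm (profile m e) \<le> C"
    by (rule continuous_bounded_cball[OF continuous_on_profile]) (rule that)
  show ?thesis
  proof (rule that[OF C(1)])
    fix x :: "real^'n"
    show "norm (radial_field m x) \<le> C * norm x powr (- m)"
      unfolding radial_field_def norm_scaleR mult.commute[of C]
      by (intro mult_mono C) (auto simp: norm_sgn)
  qed
qed

lemma set_integrable_radial_field:
  assumes "m < real CARD('n) - 1"
  shows "set_integrable lebesgue (ball 0 1) (radial_field m :: real^'n \<Rightarrow> _)"
proof -
  obtain C where "\<And>x :: real^'n. norm (radial_field m x) \<le> C * norm x powr (- m)"
    by (rule radial_field_bound) (rule that)
  then have "set_integrable lborel (ball 0 1) (radial_field m :: real^'n \<Rightarrow> _)"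
    by (intro set_integrable_norm_powr_bound[OF radial_field_borel, of m]) (use assms in auto)
  then show ?thesis
    unfolding set_integrable_def
    by (subst integrable_completion) (auto dest: borel_measurable_integrable)
qed

text \<open>Links the directional derivatives in which \<open>C_k\<close> is phrased to the gradient
  form that \<open>ball_divergence\<close> takes.\<close>

lemma gradient:
  fixes \<phi> :: "real^'n \<Rightarrow> real"
  assumes der: "\<And>x. (\<phi> has_derivative \<phi>' x) (at x)"
    and cont: "\<And>v. continuous_on UNIV (\<lambda>x. \<phi>' x v)"
  shows "(\<phi> has_derivative (\<lambda>w. (\<chi> j. \<phi>' x (axis j 1)) \<bullet> w)) (at x)"
    and "continuous_on UNIV (\<lambda>x. \<chi> j. \<phi>' x (axis j 1))"
proof -
  interpret linear "\<phi>' x" using has_derivative_linear[OF der] .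
  have "\<phi>' x w = (\<chi> j. \<phi>' x (axis j 1)) \<bullet> w" for w
  proof -
    have "\<phi>' x w = \<phi>' x (\<Sum>j\<in>UNIV. w $ j *\<^sub>R axis j 1)"
      using basis_expansion[of w] by (simp add: scalar_mult_eq_scaleR)
    then show ?thesis by (simp add: sum scale inner_vec_def mult.commute)
  qed
  then have "\<phi>' x = (\<lambda>w. (\<chi> j. \<phi>' x (axis j 1)) \<bullet> w)" by (rule ext)
  with der[of x] show "(\<phi> has_derivative (\<lambda>w. (\<chi> j. \<phi>' x (axis j 1)) \<bullet> w)) (at x)" by simp
  show "continuous_on UNIV (\<lambda>x. \<chi> j. \<phi>' x (axis j 1))"
    by (intro continuous_on_vec_lambda cont)
qed

section \<open>Weak divergence and normal trace of the radial fields\<close>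

lemma set_lebesgue_integral_lebesgue_lborel:
  fixes F :: "'a::euclidean_space \<Rightarrow> 'b::euclidean_space"
  assumes "F \<in> borel_measurable borel" "S \<in> sets borel"
  shows "(LINT x:S|lebesgue. F x) = (LINT x:S|lborel. F x)"
  unfolding set_lebesgue_integral_def using assms
  by (intro integral_completion borel_measurable_scaleR borel_measurable_indicator) simp_all

text \<open>The right side is the integrand of \<open>ball_divergence\<close> for
  \<open>v = axis i 1\<close>, with \<open>D\<close> the gradient at \<open>x\<close>.\<close>

lemma radial_field_contraction:
  fixes D x :: "real^'n"
  shows "(\<Sum>j\<in>UNIV. radial_field m x $ i $ j * D $ j) =
    norm x powr (- m) * (m * (sgn x \<bullet> axis i 1) * (D \<bullet> sgn x) + (real CARD('n) - 1 - m) * (D \<bullet> axis i 1))"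
proof -
  have "(\<Sum>j\<in>UNIV. radial_field m x $ i $ j * D $ j) =
      (\<Sum>j\<in>UNIV. norm x powr (- m) * (m * (sgn x $ i) * (D $ j * sgn x $ j)) +
        norm x powr (- m) * (real CARD('n) - 1 - m) * (if i = j then D $ j else 0))"
    by (intro sum.cong refl) (simp add: radial_field_def profile_def tensor_def mat_def algebra_simps)
  also have "\<dots> = norm x powr (- m) * (m * (sgn x $ i) * (\<Sum>j\<in>UNIV. D $ j * sgn x $ j)) +
      norm x powr (- m) * (real CARD('n) - 1 - m) * D $ i"
    by (simp add: sum.distrib sum_distrib_left[symmetric])
  also have "(\<Sum>j\<in>UNIV. D $ j * sgn x $ j) = D \<bullet> sgn x"
    by (simp add: inner_vec_def)
  finally show ?thesis by (simp add: inner_axis algebra_simps)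
qed

text \<open>This is \<open>ball_divergence\<close> for \<open>v = axis i 1\<close>: the support of a
  test function stays inside the open ball, so the boundary integral is 0.\<close>

lemma divergence_free_radial_field:
  assumes n: "2 \<le> CARD('n)" and m: "m < real CARD('n) - 1"
  shows "divergence_free (radial_field m :: real^'n \<Rightarrow> _)"
  unfolding divergence_free_def
proof (intro allI impI)
  fix i and \<phi> :: "real^'n \<Rightarrow> real"
  assume t: "test_function (ball 0 1) \<phi>"
  then have "C_k (Suc 0) \<phi>" unfolding test_function_def C_infinity_def by blast
  then have der: "(\<phi> has_derivative frechet_derivative \<phi> (at x)) (at x)"
    and cont: "continuous_on UNIV (\<lambda>x. frechet_derivative \<phi> (at x) v)" for x v
    by (auto simp: frechet_derivative_works[symmetric])
  define D where "D x = (\<chi> j. frechet_derivative \<phi> (at x) (axis j 1))" for x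
  have D: "(\<phi> has_derivative (\<lambda>w. D x \<bullet> w)) (at x)" "continuous_on UNIV D" for x
    using gradient[OF der cont] by (simp_all add: D_def[abs_def])
  have comp: "(\<lambda>x::real^'n. radial_field m x $ i $ j * D x $ j) \<in> borel_measurable borel" for j
  proof -
    have "continuous_on UNIV (\<lambda>A::real^'n^'n. A $ i $ j)" "continuous_on UNIV (\<lambda>x. D x $ j)"
      by (intro continuous_intros D)+
    from this[THEN borel_measurable_continuous_onI] show ?thesis
      by (intro borel_measurable_times) (auto intro: measurable_compose[OF radial_field_borel])
  qed
  obtain C where C: "0 \<le> C" "\<And>x :: real^'n. norm (radial_field m x) \<le> C * norm x powr (- m)"
    by (rule radial_field_bound) (rule that)
  obtain A where A: "0 \<le> A" "\<And>x. norm x \<le> 1 \<Longrightarrow> norm (D x) \<le> A"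
    by (rule continuous_bounded_cball[OF D(2)]) (rule that)
  \<comment> \<open>The weak formulation has one integral for each \<open>j\<close>, so every
    product must be integrable on its own before the sum can be moved inside.\<close>
  have int: "set_integrable lborel (ball 0 1) (\<lambda>x. radial_field m x $ i $ j * D x $ j)" for j
  proof (rule set_integrable_norm_powr_bound[OF comp, where a=m and C="C * A"])
    fix x :: "real^'n" assume x: "x \<in> ball 0 1"
    have "\<bar>radial_field m x $ i $ j\<bar> \<le> norm (radial_field m x)"
      using Finite_Cartesian_Product.norm_nth_le[of "radial_field m x $ i" j] Finite_Cartesian_Product.norm_nth_le[of "radial_field m x" i] by simp
    then have "\<bar>radial_field m x $ i $ j\<bar> \<le> C * norm x powr (- m)" using C(2)[of x] by simp
    moreover have "\<bar>D x $ j\<bar> \<le> A" using A(2)[of x] x Finite_Cartesian_Product.norm_nth_le[of "D x" j] by simp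
    ultimately have "\<bar>radial_field m x $ i $ j\<bar> * \<bar>D x $ j\<bar> \<le> (C * norm x powr (- m)) * A"
      using C(1) by (intro mult_mono) auto
    then show "norm (radial_field m x $ i $ j * D x $ j) \<le> C * A * norm x powr (- m)"
      by (simp add: abs_mult mult_ac)
  qed (use m in simp)
  have "(\<Sum>j\<in>UNIV. LINT x:ball 0 1|lebesgue. radial_field m x $ i $ j * frechet_derivative \<phi> (at x) (axis j 1)) =
      (\<Sum>j\<in>UNIV. LINT x:ball 0 1|lborel. radial_field m x $ i $ j * D x $ j)"
    using comp by (intro sum.cong refl) (simp add: D_def set_lebesgue_integral_lebesgue_lborel)
  also have "\<dots> = (LINT x:ball 0 1|lborel. (\<Sum>j\<in>UNIV. radial_field m x $ i $ j * D x $ j))"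
    using int unfolding set_lebesgue_integral_def set_integrable_def scaleR_sum_right
    by (intro Bochner_Integration.integral_sum[symmetric]) simp
  also have "\<dots> = (real CARD('n) - 1) * (LINT e|sphere_measure. (e \<bullet> axis i 1) * \<phi> e)"
    unfolding radial_field_contraction by (rule ball_divergence(2)[OF n m D])
  also have "(LINT e|sphere_measure. (e \<bullet> axis i 1) * \<phi> e) = (LINT e|(sphere_measure :: (real^'n) measure). 0)"
  proof (rule Bochner_Integration.integral_cong[OF refl])
    fix e :: "real^'n" assume "e \<in> space sphere_measure"
    then have "\<phi> e = 0"
      using t closure_subset[of "{x. \<phi> x \<noteq> 0}"] by (force simp: test_function_def)
    then show "(e \<bullet> axis i 1) * \<phi> e = 0" by simp
  qed
  finally show "(\<Sum>j\<in>UNIV. LINT x:ball 0 1|lebesgue. radial_field m x $ i $ j * frechet_derivative \<phi> (at x) (axis j 1)) = 0"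
    by simp
qed

text \<open>Apply \<open>ball_divergence\<close> to each component of \<open>\<psi>\<close> with
  \<open>v = axis i 1\<close> and sum over \<open>i\<close>. The density is T(e) e, that is,
  \<open>e\<close> times the eigenvalue of the profile along \<open>e\<close>.\<close>

lemma normal_trace_radial_field:
  assumes n: "2 \<le> CARD('n)" and m: "m < real CARD('n) - 1"
  shows "has_integrable_normal_trace (radial_field m :: real^'n \<Rightarrow> _) (\<lambda>e. (real CARD('n) - 1) *\<^sub>R e)"
  unfolding has_integrable_normal_trace_def
proof (intro conjI allI impI)
  show "integrable sphere_measure (\<lambda>e::real^'n. (real CARD('n) - 1) *\<^sub>R e)"
    by (intro integrable_sphere_measure continuous_intros)
  fix \<psi> :: "real^'n \<Rightarrow> real^'n"
  assume "C_infinity \<psi>"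
  then have "C_k (Suc 0) \<psi>" unfolding C_infinity_def by blast
  then have der: "(\<psi> has_derivative frechet_derivative \<psi> (at x)) (at x)"
    and cont: "continuous_on UNIV (\<lambda>x. frechet_derivative \<psi> (at x) v)" for x v
    by (auto simp: frechet_derivative_works[symmetric])
  define D where "D i x = (\<chi> j. frechet_derivative \<psi> (at x) (axis j 1) $ i)" for i x
  have D: "((\<lambda>x. \<psi> x $ i) has_derivative (\<lambda>w. D i x \<bullet> w)) (at x)" "continuous_on UNIV (D i)" for i x
  proof -
    have d: "((\<lambda>x. \<psi> x $ i) has_derivative (\<lambda>w. frechet_derivative \<psi> (at x) w $ i)) (at x)" for x
      by (rule bounded_linear.has_derivative[OF bounded_linear_vec_nth der])
    have c: "continuous_on UNIV (\<lambda>x. frechet_derivative \<psi> (at x) v $ i)" for v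
      by (intro continuous_intros cont)
    show "((\<lambda>x. \<psi> x $ i) has_derivative (\<lambda>w. D i x \<bullet> w)) (at x)" "continuous_on UNIV (D i)"
      using gradient[OF d c] by (simp_all add: D_def[abs_def])
  qed
  define F where "F i x = norm x powr (- m) *
      (m * (sgn x \<bullet> axis i 1) * (D i x \<bullet> sgn x) + (real CARD('n) - 1 - m) * (D i x \<bullet> axis i 1))" for i x
  have F: "set_integrable lborel (ball 0 1) (F i)"
    "(LINT x:ball 0 1|lborel. F i x) = (real CARD('n) - 1) * (LINT e|sphere_measure. (e \<bullet> axis i 1) * \<psi> e $ i)" for i
    unfolding F_def by (rule ball_divergence[OF n m D])+
  have tr: "trace (radial_field m x ** jacobian \<psi> (at x)) = (\<Sum>i\<in>UNIV. F i x)" for x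
  proof -
    have "jacobian \<psi> (at x) $ i $ j = D i x $ j" for i j
      by (simp add: jacobian_def matrix_def D_def)
    then have "trace (radial_field m x ** jacobian \<psi> (at x)) =
        (\<Sum>j\<in>UNIV. \<Sum>i\<in>UNIV. radial_field m x $ j $ i * D i x $ j)"
      by (simp add: trace_def matrix_matrix_mult_def)
    \<comment> \<open>After the exchange of sums the indices of the field stand in the wrong order;
      its symmetry repairs this.\<close>
    also have "\<dots> = (\<Sum>i\<in>UNIV. \<Sum>j\<in>UNIV. radial_field m x $ i $ j * D i x $ j)"
      by (subst sum.swap) (simp add: radial_field_def profile_def tensor_def mat_def mult_ac eq_commute)
    also have "\<dots> = (\<Sum>i\<in>UNIV. F i x)"
      by (simp only: radial_field_contraction F_def)
    finally show ?thesis .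
  qed
  have Fm: "F i \<in> borel_measurable borel" for i
    using borel_measurable_continuous_onI[OF D(2)] sgn_borel_measurable unfolding F_def[abs_def] by measurable
  have "(LINT x:ball 0 1|lebesgue. trace (radial_field m x ** jacobian \<psi> (at x))) =
      (LINT x:ball 0 1|lborel. (\<Sum>i\<in>UNIV. F i x))"
    unfolding tr by (intro set_lebesgue_integral_lebesgue_lborel borel_measurable_sum Fm) simp
  also have "\<dots> = (\<Sum>i\<in>UNIV. LINT x:ball 0 1|lborel. F i x)"
    using F(1) unfolding set_lebesgue_integral_def set_integrable_def scaleR_sum_right
    by (intro Bochner_Integration.integral_sum) simp
  also have "\<dots> = (\<Sum>i\<in>UNIV. LINT e|sphere_measure. (real CARD('n) - 1) * ((e \<bullet> axis i 1) * \<psi> e $ i))"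
    by (simp add: F(2))
  also have "\<dots> = (LINT e|sphere_measure. (\<Sum>i\<in>UNIV. (real CARD('n) - 1) * ((e \<bullet> axis i 1) * \<psi> e $ i)))"
  proof (rule Bochner_Integration.integral_sum[symmetric])
    fix i
    have "continuous_on UNIV \<psi>"
      using has_derivative_continuous[OF der] by (simp add: continuous_on_eq_continuous_at)
    then have c: "continuous_on (sphere 0 1) \<psi>"
      by (rule continuous_on_subset) simp
    show "integrable sphere_measure (\<lambda>e. (real CARD('n) - 1) * ((e \<bullet> axis i 1) * \<psi> e $ i))"
      by (intro integrable_sphere_measure continuous_intros c)
  qed
  also have "\<dots> = (LINT e|sphere_measure. (real CARD('n) - 1) *\<^sub>R e \<bullet> \<psi> e)"
    by (intro Bochner_Integration.integral_cong refl)
      (simp add: inner_vec_def[of _ "\<psi> _"] inner_axis sum_distrib_left mult.assoc)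
  finally show "(LINT e|sphere_measure. (real CARD('n) - 1) *\<^sub>R e \<bullet> \<psi> e) =
      (LINT x:ball 0 1|lebesgue. trace (radial_field m x ** jacobian \<psi> (at x)))"
    by simp
qed

section \<open>The spherical estimate and the vanishing on rank-one tensors\<close>

lemma profile_limit: "profile (real CARD('n) - 1) (e :: real^'n) = (real CARD('n) - 1) *\<^sub>R tensor e e"
  by (simp add: profile_def)

lemma radial_field_scaleR:
  assumes "0 < r" "norm e = 1"
  shows "radial_field m (r *\<^sub>R e) = r powr (- m) *\<^sub>R profile m e"
  using assms by (simp add: radial_field_def sgn_div_norm)

theorem lemma3p2:
  fixes f :: "real^'n^'n \<Rightarrow> real"
  assumes "CARD('n) \<ge> 2"
    and "continuous_on Sym_psd f"
    and "\<And>A. A \<in> Sym_psd \<Longrightarrow> 0 \<le> f A"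
    and "\<And>A t. A \<in> Sym_psd \<Longrightarrow> 0 < t \<Longrightarrow>
           f (t *\<^sub>R A) = t powr (real CARD('n) / (real CARD('n) - 1)) * f A"
    and "maximal_gain_of_integrability f"
  shows "(\<exists>c'::real. \<forall>m::real. m < real CARD('n) - 1 \<longrightarrow>
            (LINT e|sphere_measure.
               f (m *\<^sub>R tensor e e + (real CARD('n) - 1 - m) *\<^sub>R mat 1))
            \<le> c' * (real CARD('n) - 1 - m))
       \<and> (\<forall>v. f (tensor v v) = 0)"
proof -
  define d where "d = real CARD('n)"
  have d: "2 \<le> d" using assms(1) by (simp add: d_def)
  \<comment> \<open>Nothing is known about \<open>f\<close> outside the cone, not even
    measurability. The extension by zero is Borel and nonnegative everywhere, as the integration
    theorems require, and agrees with \<open>f\<close> at all tensors in play.\<close>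
  define h where "h A = indicator Sym_psd A *\<^sub>R f A" for A
  have hm: "h \<in> borel_measurable borel"
    unfolding h_def[abs_def] using borel_closed[OF closed_Sym_psd] assms(2)
    by (rule borel_measurable_continuous_on_indicator)
  have h: "h A = f A" if "A \<in> Sym_psd" for A using that by (simp add: h_def)
  have h0: "0 \<le> h A" for A using assms(3) by (simp add: h_def indicator_def)
  obtain c where c: "0 \<le> c" and gain: "\<And>T g. set_integrable lebesgue (ball 0 1) T \<Longrightarrow>
     (AE x in lebesgue. x \<in> ball 0 1 \<longrightarrow> T x \<in> Sym_psd) \<Longrightarrow> divergence_free T \<Longrightarrow>
     has_integrable_normal_trace T g \<Longrightarrow>
     (\<integral>\<^sup>+x\<in>ball 0 1. ennreal (f (T x)) \<partial>lebesgue)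
       \<le> ennreal (c * (LINT e|sphere_measure. norm (g e)) powr (d / (d - 1)))"
    using assms(5) unfolding maximal_gain_of_integrability_def d_def by blast
  \<comment> \<open>The bound that the gain hypothesis gives for the trace
    \<open>(d - 1) *\<^sub>R e\<close>. It does not involve \<open>m\<close>, so one constant serves
    all fields.\<close>
  define P where "P = c * (LINT e|(sphere_measure :: (real^'n) measure). norm ((d - 1) *\<^sub>R e)) powr (d / (d - 1))"
  have P: "0 \<le> P" unfolding P_def using c by simp
  define J where "J m = (\<integral>\<^sup>+e. ennreal (h (profile m e)) \<partial>(sphere_measure :: (real^'n) measure))" for m
  define c' where "c' = d / (d - 1) * P"
  have J_bound: "J m \<le> ennreal (c' * (d - 1 - m))" if m: "m < d - 1" for m
  proof -
    \<comment> \<open>The radial integral of r^(-m d/(d-1)) against r^(d-1) is \<open>1 / q\<close>.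
      The estimate on the ball thus reads \<open>J m / q \<le> P\<close>, and \<open>q * P\<close>
      is \<open>c' * (d - 1 - m)\<close>.\<close>
    define q where "q = d - m * (d / (d - 1))"
    have q_eq: "q = d / (d - 1) * (d - 1 - m)" using d by (simp add: q_def field_simps)
    have q: "0 < q" unfolding q_eq using d m by simp
    have m': "m < real CARD('n) - 1" using m by (simp add: d_def)
    have hT: "h (radial_field m x) = f (radial_field m x)" for x
      by (rule h[OF radial_field_Sym_psd[OF m']])
    have "ennreal (1 / q) * J m = (\<integral>\<^sup>+r. ennreal (r powr (- (m * (d / (d - 1))))) * J m \<partial>radial_measure CARD('n))"
      using nn_integral_powr_radial_measure[of "CARD('n)" "m * (d / (d - 1))"] q
      by (subst nn_integral_multc) (simp_all add: measurable_cong_sets[OF sets_radial_measure refl] q_def d_def)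
    also have "\<dots> = (\<integral>\<^sup>+r. \<integral>\<^sup>+e. ennreal (h (radial_field m (r *\<^sub>R e))) \<partial>(sphere_measure :: (real^'n) measure) \<partial>radial_measure CARD('n))"
    proof (rule nn_integral_cong_AE, use AE_radial_measure in eventually_elim)
      fix r :: real assume r: "0 < r \<and> r < 1"
      have "ennreal (r powr (- (m * (d / (d - 1))))) * J m =
          (\<integral>\<^sup>+e. ennreal (r powr (- (m * (d / (d - 1))))) * ennreal (h (profile m e)) \<partial>(sphere_measure :: (real^'n) measure))"
        unfolding J_def
        by (rule nn_integral_cmult[symmetric])
          (intro measurable_compose[OF id_borel_measurable_sphere_measure] measurable_compose[OF _ measurable_ennreal]
            measurable_compose[OF _ hm] borel_measurable_continuous_onI continuous_on_profile)
      also have "\<dots> = (\<integral>\<^sup>+e. ennreal (h (radial_field m (r *\<^sub>R e))) \<partial>(sphere_measure :: (real^'n) measure))"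
      proof (rule nn_integral_cong)
        fix e :: "real^'n" assume "e \<in> space sphere_measure"
        then have e: "norm e = 1" by simp
        have "h (radial_field m (r *\<^sub>R e)) = (r powr (- m)) powr (d / (d - 1)) * f (profile m e)"
          unfolding hT using r e assms(4)[OF profile_Sym_psd[OF m' e], of "r powr (- m)"]
          by (simp add: radial_field_scaleR d_def)
        also have "(r powr (- m)) powr (d / (d - 1)) = r powr (- (m * (d / (d - 1))))"
          by (simp add: powr_powr)
        finally show "ennreal (r powr (- (m * (d / (d - 1))))) * ennreal (h (profile m e)) =
            ennreal (h (radial_field m (r *\<^sub>R e)))"
          using h[OF profile_Sym_psd[OF m' e]] by (simp add: ennreal_mult')
      qed
      finally show "ennreal (r powr (- (m * (d / (d - 1))))) * J m =
          (\<integral>\<^sup>+e. ennreal (h (radial_field m (r *\<^sub>R e))) \<partial>(sphere_measure :: (real^'n) measure))" .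
    qed
    also have "\<dots> = (\<integral>\<^sup>+x\<in>ball 0 1. ennreal (h (radial_field m x)) \<partial>(lborel :: (real^'n) measure))"
      by (intro nn_integral_polar[symmetric] measurable_compose[OF _ measurable_ennreal]
        measurable_compose[OF radial_field_borel hm])
    also have "\<dots> = (\<integral>\<^sup>+x\<in>ball 0 1. ennreal (f (radial_field m x)) \<partial>(lebesgue :: (real^'n) measure))"
      by (simp only: nn_integral_completion hT)
    also have "\<dots> \<le> ennreal P"
      unfolding P_def d_def
      by (intro gain[unfolded d_def] set_integrable_radial_field divergence_free_radial_field normal_trace_radial_field
        assms(1) m' AE_I2 impI radial_field_Sym_psd)
    finally have "ennreal q * (ennreal (1 / q) * J m) \<le> ennreal q * ennreal P"
      by (intro mult_left_mono) auto
    also have "ennreal q * (ennreal (1 / q) * J m) = J m"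
      using q by (simp add: mult.assoc[symmetric] ennreal_mult'[symmetric])
    also have "ennreal q * ennreal P = ennreal (c' * (d - 1 - m))"
      using q P by (simp add: ennreal_mult'[symmetric] c'_def q_eq mult_ac)
    finally show ?thesis .
  qed
  have bound: "(LINT e|sphere_measure. f (profile m e)) \<le> c' * (d - 1 - m)" if m: "m < d - 1" for m
  proof -
    have m': "m < real CARD('n) - 1" using m by (simp add: d_def)
    have "(LINT e|sphere_measure. f (profile m e)) = (LINT e|sphere_measure. h (profile m e))"
      by (rule Bochner_Integration.integral_cong[OF refl]) (simp add: h profile_Sym_psd[OF m'])
    also have "\<dots> = enn2real (J m)"
      unfolding J_def
      by (rule integral_eq_nn_integral)
        (auto intro!: h0 measurable_compose[OF id_borel_measurable_sphere_measure] measurable_compose[OF _ hm]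
          borel_measurable_continuous_onI continuous_on_profile)
    also have "\<dots> \<le> c' * (d - 1 - m)"
      using J_bound[OF m] d P m by (intro enn2real_leI) (auto simp: c'_def)
    finally show ?thesis .
  qed
  have S: "profile (d - 1) e \<in> Sym_psd" for e :: "real^'n"
    unfolding d_def profile_limit using d by (intro scaleR_Sym_psd tensor_Sym_psd) (simp add: d_def)
  define K where "K = (\<integral>\<^sup>+e. ennreal (h (profile (d - 1) e)) \<partial>(sphere_measure :: (real^'n) measure))"
  \<comment> \<open>The parameters approach \<open>d - 1\<close> from below, where
    \<open>J_bound\<close> is available, and the bounds \<open>c' * inverse (real (Suc i))\<close>
    tend to 0. The integrands converge pointwise because \<open>f\<close> is continuous on the cone
    and the limit tensor belongs to it.\<close>
  have "K \<le> liminf (\<lambda>i. J (d - 1 - inverse (real (Suc i))))"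
  proof -
    have "K = (\<integral>\<^sup>+e. liminf (\<lambda>i. ennreal (h (profile (d - 1 - inverse (real (Suc i))) e))) \<partial>(sphere_measure :: (real^'n) measure))"
      unfolding K_def
    proof (rule nn_integral_cong)
      fix e :: "real^'n" assume "e \<in> space sphere_measure"
      then have e: "norm e = 1" by simp
      have Si: "profile (d - 1 - inverse (real (Suc i))) e \<in> Sym_psd" for i
        by (rule profile_Sym_psd[OF _ e]) (simp add: d_def)
      have "(\<lambda>i. d - 1 - inverse (real (Suc i))) \<longlonglongrightarrow> d - 1 - 0"
        by (intro tendsto_intros LIMSEQ_inverse_real_of_nat)
      then have lim: "(\<lambda>i. d - 1 - inverse (real (Suc i))) \<longlonglongrightarrow> d - 1" by simp
      have "(\<lambda>i. profile (d - 1 - inverse (real (Suc i))) e) \<longlonglongrightarrow> profile (d - 1) e"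
        unfolding profile_def by (intro tendsto_add tendsto_scaleR tendsto_diff[of "\<lambda>_. real CARD('n) - 1"] tendsto_const lim)
      then have "(\<lambda>i. f (profile (d - 1 - inverse (real (Suc i))) e)) \<longlonglongrightarrow> f (profile (d - 1) e)"
        by (rule continuous_on_tendsto_compose[OF assms(2) _ S])
          (intro always_eventually allI Si)
      then have "(\<lambda>i. ennreal (h (profile (d - 1 - inverse (real (Suc i))) e))) \<longlonglongrightarrow> ennreal (h (profile (d - 1) e))"
        unfolding h[OF S] h[OF Si] by (rule tendsto_ennrealI)
      from lim_imp_Liminf[OF _ this]
      show "ennreal (h (profile (d - 1) e)) = liminf (\<lambda>i. ennreal (h (profile (d - 1 - inverse (real (Suc i))) e)))"
        by simp
    qed
    also have "\<dots> \<le> liminf (\<lambda>i. J (d - 1 - inverse (real (Suc i))))"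
      unfolding J_def
      by (intro nn_integral_liminf measurable_compose[OF id_borel_measurable_sphere_measure]
        measurable_compose[OF _ measurable_ennreal] measurable_compose[OF _ hm]
        borel_measurable_continuous_onI continuous_on_profile)
    finally show ?thesis .
  qed
  also have "\<dots> \<le> liminf (\<lambda>i. ennreal (c' * inverse (real (Suc i))))"
    by (intro Liminf_mono always_eventually allI order_trans[OF J_bound]) auto
  also have "\<dots> = 0"
  proof -
    have "(\<lambda>i. c' * inverse (real (Suc i))) \<longlonglongrightarrow> c' * 0"
      by (intro tendsto_intros LIMSEQ_inverse_real_of_nat)
    then have "(\<lambda>i. ennreal (c' * inverse (real (Suc i)))) \<longlonglongrightarrow> ennreal (c' * 0)"
      by (rule tendsto_ennrealI)
    from lim_imp_Liminf[OF _ this] show ?thesis by simp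
  qed
  finally have K: "K = 0" by simp
  have ct: "continuous_on UNIV (\<lambda>x :: real^'n. f (tensor x x))"
    by (rule continuous_on_compose2[OF assms(2) continuous_on_tensor]) (auto simp: tensor_Sym_psd)
  \<comment> \<open>\<open>K = 0\<close> gives vanishing only for almost every direction. Spreading
    \<open>f (tensor x x)\<close> over the ball turns this into a statement about Lebesgue measure,
    where an open null set is known to be empty.\<close>
  have "(\<integral>\<^sup>+x\<in>ball 0 1. ennreal (f (tensor x x)) \<partial>(lborel :: (real^'n) measure)) =
      (\<integral>\<^sup>+r. \<integral>\<^sup>+e. ennreal (f (tensor (r *\<^sub>R e) (r *\<^sub>R e))) \<partial>(sphere_measure :: (real^'n) measure) \<partial>radial_measure CARD('n))"
    by (intro nn_integral_polar measurable_compose[OF _ measurable_ennreal] borel_measurable_continuous_onI ct)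
  also have "\<dots> = (\<integral>\<^sup>+r. 0 \<partial>radial_measure CARD('n))"
  proof (rule nn_integral_cong_AE, use AE_radial_measure in eventually_elim)
    fix r :: real assume r: "0 < r \<and> r < 1"
    \<comment> \<open>\<open>tensor (r *\<^sub>R e) (r *\<^sub>R e)\<close> is
      \<open>r\<^sup>2 / (d - 1)\<close> times the limit profile; homogeneity turns that ratio into
      \<open>s\<close>.\<close>
    define s where "s = (r\<^sup>2 / (d - 1)) powr (d / (d - 1))"
    have "(\<integral>\<^sup>+e. ennreal (f (tensor (r *\<^sub>R e) (r *\<^sub>R e))) \<partial>(sphere_measure :: (real^'n) measure)) =
        (\<integral>\<^sup>+e. ennreal s * ennreal (h (profile (d - 1) e)) \<partial>(sphere_measure :: (real^'n) measure))"
    proof (rule nn_integral_cong)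
      fix e :: "real^'n"
      have "tensor (r *\<^sub>R e) (r *\<^sub>R e) = (r\<^sup>2 / (d - 1)) *\<^sub>R profile (d - 1) e"
        unfolding d_def profile_limit using d by (simp add: tensor_scaleR d_def)
      then have "f (tensor (r *\<^sub>R e) (r *\<^sub>R e)) = s * f (profile (d - 1) e)"
        using assms(4)[OF S, of "r\<^sup>2 / (d - 1)"] r d by (simp add: s_def d_def)
      then show "ennreal (f (tensor (r *\<^sub>R e) (r *\<^sub>R e))) = ennreal s * ennreal (h (profile (d - 1) e))"
        using S by (simp add: h ennreal_mult' s_def)
    qed
    also have "\<dots> = ennreal s * K"
      unfolding K_def
      by (rule nn_integral_cmult)
        (intro measurable_compose[OF id_borel_measurable_sphere_measure] measurable_compose[OF _ measurable_ennreal]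
          measurable_compose[OF _ hm] borel_measurable_continuous_onI continuous_on_profile)
    finally show "(\<integral>\<^sup>+e. ennreal (f (tensor (r *\<^sub>R e) (r *\<^sub>R e))) \<partial>(sphere_measure :: (real^'n) measure)) = 0"
      by (simp add: K)
  qed
  finally have "(\<integral>\<^sup>+x\<in>ball 0 1. ennreal (f (tensor x x)) \<partial>(lborel :: (real^'n) measure)) = 0"
    by simp
  then have "AE x in (lborel :: (real^'n) measure). ennreal (f (tensor x x)) * indicator (ball 0 1) x = 0"
    using borel_measurable_continuous_onI[OF ct]
    by (subst (asm) nn_integral_0_iff_AE)
      (auto intro!: borel_measurable_times_ennreal borel_measurable_indicator measurable_compose[OF _ measurable_ennreal])
  then have AE0: "AE x in (lborel :: (real^'n) measure). x \<notin> {x \<in> ball 0 1. f (tensor x x) \<noteq> 0}"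
    by eventually_elim (use assms(3)[OF tensor_Sym_psd] in \<open>auto simp: indicator_def ennreal_eq_0_iff antisym\<close>)
  have "open ({x. f (tensor x x) \<noteq> 0} \<inter> ball 0 1)"
    using ct by (intro open_Int open_Collect_neq) auto
  also have "{x. f (tensor x x) \<noteq> 0} \<inter> ball 0 1 = {x \<in> ball 0 1. f (tensor x x) \<noteq> 0}"
    by blast
  finally have op: "open {x \<in> ball 0 1. f (tensor x x) \<noteq> 0}" .
  have "{x \<in> ball 0 1. f (tensor x x) \<noteq> 0} \<in> null_sets lborel"
    using AE0 op by (simp add: AE_iff_null_sets)
  then have "negligible {x \<in> ball 0 1. f (tensor x x) \<noteq> 0}"
    by (simp add: negligible_iff_null_sets null_sets_completionI)
  then have empty: "{x \<in> ball 0 1. f (tensor x x) \<noteq> 0} = {}"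
    using open_not_negligible[OF op] by blast
  have "f (tensor v v) = 0" for v :: "real^'n"
  proof -
    \<comment> \<open>Dividing by \<open>norm v + 1\<close> lands in the open ball and covers
      \<open>v = 0\<close> too; homogeneity with factor \<open>(norm v + 1)\<^sup>2\<close> leads
      back to \<open>v\<close>.\<close>
    define x where "x = (1 / (norm v + 1)) *\<^sub>R v"
    have pos: "0 < norm v + 1" using norm_ge_zero[of v] by linarith
    have "x \<in> ball 0 1" using pos by (simp add: x_def)
    then have "f (tensor x x) = 0" using empty by blast
    moreover have "tensor v v = (norm v + 1)\<^sup>2 *\<^sub>R tensor x x"
      using pos by (simp add: tensor_scaleR[symmetric] x_def)
    ultimately show ?thesis
      using assms(4)[OF tensor_Sym_psd[of x], of "(norm v + 1)\<^sup>2"] pos by simp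
  qed
  then show ?thesis
    using bound unfolding d_def profile_def by blast
qed

end
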